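(* Let $(\mathcal A,\delta)$ be a $C^*$-dynamical system, let $J$ be an ideal in $\mathcal A$ having zero intersection with the kernel $I$ of $\delta$, and let $(\pi_i,U_i,H_i)$, $i=1,2$, be covariant representations of $(\mathcal A,\delta)$ associated with $J$ and possessing property $( * )$. Then the relations $$\Phi(\pi_1(a)):=\pi_2(a),\quad a\in\mathcal A,\qquad\Phi(U_1):=U_2$$ give rise to an isomorphism $\Phi$ between the $C^*$-algebras $C^*(\pi_1(\mathcal A),U_1)$ and $C^*(\pi_2(\mathcal A),U_2)$.
   Context: A $C^*$-dynamical system $(\mathcal A,\delta)$ is a unital $C^*$-algebra $\mathcal A$ with a $*$-endomorphism $\delta:\mathcal A\to\mathcal A$ (not assumed unital or injective). A covariant representation of $(\mathcal A,\delta)$ is a triple $(\pi,U,H)$ where $\pi:\mathcal A\to\mathcal B(H)$ is a non-degenerate faithful $*$-representation on a Hilbert space $H$ and $U\in\mathcal B(H)$ is a partial isometry with $U\pi(a)U^*=\pi(\delta(a))$ for all $a\in\mathcal A$ and $U^*U\in\pi(\mathcal A)'$ (the commutant). Ideals are closed and two-sided. A covariant representation $(\pi,U,H)$ is associated with an ideal $J$ (where $J\cap\operatorname{Ker}\delta=\{0\}$) if $J=\{a\in\mathcal A: U^*U\pi(a)=\pi(a)\}$. $C^*(\pi(\mathcal A),U)$ is the $C^*$-subalgebra of $\mathcal B(H)$ generated by $\pi(\mathcal A)$ and $U$. $\mathbb N=\{0,1,2,\dots\}$. $\mathcal M(\mathcal A)$ is the set of infinite matrices $\{a_{m,n}\}_{m,n\in\mathbb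 N}$ with $a_{m,n}\in\delta^m(1)\mathcal A\delta^n(1)$ and only finitely many non-zero entries. A covariant representation $(\pi,U,H)$ possesses property $( * )$ if for every $\{a_{m,n}\}\in\mathcal M(\mathcal A)$ $$\Big\|\sum_{m\in\mathbb N}U^{*m}\pi(a_{m,m})U^m\Big\|\le\Big\|\sum_{m,n\in\mathbb N}U^{*m}\pi(a_{m,n})U^n\Big\|.$$ *)

theory Defs
  imports "HOL-Analysis.Analysis"
begin

section \<open>Complex Hilbert spaces\<close>

class complex_vector = real_vector +
  fixes scaleC :: "complex \<Rightarrow> 'a \<Rightarrow> 'a" (infixr "*\<^sub>C" 75)
  assumes scaleC_add_right: "c *\<^sub>C (x + y) = c *\<^sub>C x + c *\<^sub>C y"
    and scaleC_add_left: "(c + d) *\<^sub>C x = c *\<^sub>C x + d *\<^sub>C x"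
    and scaleC_scaleC: "c *\<^sub>C (d *\<^sub>C x) = (c * d) *\<^sub>C x"
    and scaleC_of_real: "complex_of_real r *\<^sub>C x = r *\<^sub>R x"

lemma scaleC_one: "1 *\<^sub>C x = (x :: 'a :: complex_vector)"
  using scaleC_of_real[of 1 x] by simp

global_interpretation complex_vector: vector_space "scaleC :: complex \<Rightarrow> 'a \<Rightarrow> 'a :: complex_vector"
  by unfold_locales (simp_all add: scaleC_add_right scaleC_add_left scaleC_scaleC scaleC_one)

class complex_normed_vector = complex_vector + real_normed_vector +
  assumes norm_scaleC: "norm (c *\<^sub>C x) = cmod c * norm x"

text \<open>The inner product is linear in the first argument.\<close>

class complex_inner = complex_normed_vector +
  fixes cinner :: "'a \<Rightarrow> 'a \<Rightarrow> complex"
  assumes cinner_add_left: "cinner (x + y) z = cinner x z + cinner y z"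
    and cinner_scaleC_left: "cinner (c *\<^sub>C x) y = c * cinner x y"
    and cinner_commute: "cinner x y = cnj (cinner y x)"
    and cinner_self: "cinner x x = complex_of_real ((norm x)\<^sup>2)"

class chilbert_space = complex_inner + banach

lemma cinner_add_right: "cinner x (y + z) = cinner x y + cinner x z"
  by (subst (1 2 3) cinner_commute) (simp add: cinner_add_left)

lemma cinner_scaleC_right: "cinner x (c *\<^sub>C y) = cnj c * cinner x y"
  by (subst (1 2) cinner_commute) (simp add: cinner_scaleC_left)

lemma cinner_scaleR_left: "cinner (r *\<^sub>R x) y = of_real r * cinner x y"
  by (simp add: scaleC_of_real[symmetric] cinner_scaleC_left)

lemma cinner_scaleR_right: "cinner x (r *\<^sub>R y) = of_real r * cinner x y"
  by (simp add: scaleC_of_real[symmetric] cinner_scaleC_right)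

lemma cinner_minus_left: "cinner (- x) y = - cinner x y"
  using cinner_scaleR_left[of "-1" x y] by simp

lemma cinner_minus_right: "cinner x (- y) = - cinner x y"
  using cinner_scaleR_right[of x "-1" y] by simp

lemma cinner_diff_left: "cinner (x - y) z = cinner x z - cinner y z"
  using cinner_add_left[of x "- y" z] by (simp add: cinner_minus_left)

lemma cinner_diff_right: "cinner x (y - z) = cinner x y - cinner x z"
  using cinner_add_right[of x y "- z"] by (simp add: cinner_minus_right)

lemma Re_cinner_commute: "Re (cinner x y) = Re (cinner y x)"
  by (subst cinner_commute) simp

lemma norm_add_sq: "(norm (x + y))\<^sup>2 = (norm x)\<^sup>2 + (norm y)\<^sup>2 + 2 * Re (cinner x y)"
  for x y :: "'a :: complex_inner"
proof -
  have "complex_of_real ((norm (x + y))\<^sup>2)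
      = of_real ((norm x)\<^sup>2) + cinner x y + (cinner y x + of_real ((norm y)\<^sup>2))"
    by (simp only: cinner_self[symmetric] cinner_add_left cinner_add_right) simp
  then have "Re (complex_of_real ((norm (x + y))\<^sup>2))
      = Re (of_real ((norm x)\<^sup>2) + cinner x y + (cinner y x + of_real ((norm y)\<^sup>2)))"
    by (rule arg_cong)
  then show ?thesis
    using Re_cinner_commute[of x y] by simp
qed

lemma Re_cinner_le: "Re (cinner x y) \<le> norm x * norm y"
  for x y :: "'a :: complex_inner"
proof -
  have "(norm (x + y))\<^sup>2 \<le> (norm x + norm y)\<^sup>2"
    by (intro power_mono norm_triangle_ineq norm_ge_zero)
  then show ?thesis
    by (simp add: norm_add_sq power2_sum)
qed

lemma cinner_eqI:
  fixes y z :: "'a :: complex_inner"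
  assumes "\<And>x. cinner x y = cinner x z"
  shows "y = z"
proof -
  have "cinner (y - z) (y - z) = 0"
    by (simp add: cinner_diff_right assms)
  then show ?thesis
    by (simp add: cinner_self)
qed

lemma parallelogram: "(norm (x + y))\<^sup>2 + (norm (x - y))\<^sup>2 = 2 * (norm x)\<^sup>2 + 2 * (norm y)\<^sup>2"
  for x y :: "'a :: complex_inner"
  using norm_add_sq[of x y] norm_add_sq[of x "- y"] by (simp add: cinner_minus_right)

text \<open>Riesz representation: the representing vector minimises
  \<open>\<parallel>x\<parallel>\<^sup>2 - 2 g(x)\<close>.\<close>

lemma riesz_real:
  fixes g :: "'a :: chilbert_space \<Rightarrow> real"
  assumes g: "bounded_linear g"
  shows "\<exists>z. \<forall>x. g x = Re (cinner x z)"
proof -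
  interpret g: bounded_linear g by (rule g)
  define q where "q x = (norm x)\<^sup>2 - 2 * g x" for x
  obtain K where K: "\<And>x. norm (g x) \<le> norm x * K" "K \<ge> 0"
    using g.nonneg_bounded by blast
  have lower: "q x \<ge> - K\<^sup>2" for x
  proof -
    have "0 \<le> (norm x - K)\<^sup>2" by simp
    moreover have "g x \<le> norm x * K" using K(1)[of x] by simp
    ultimately show ?thesis by (simp add: q_def power2_diff)
  qed
  define m where "m = (INF x. q x)"
  have bdd: "bdd_below (range q)"
    using lower by (intro bdd_belowI2[where m = "- K\<^sup>2"]) auto
  have m_le: "m \<le> q x" for x
    unfolding m_def by (rule cINF_lower[OF bdd]) simp
  have "\<exists>x. q x < m + 1 / real (Suc n)" for n
    using cINF_less_iff[of UNIV q "m + 1 / real (Suc n)"] bdd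
    by (auto simp: m_def)
  then obtain X where X: "\<And>n. q (X n) < m + 1 / real (Suc n)"
    by metis
  have q_par: "(norm (x - y))\<^sup>2 \<le> 2 * (q x - m) + 2 * (q y - m)" for x y
  proof -
    have "q ((1/2) *\<^sub>R (x + y)) = (norm (x + y))\<^sup>2 / 4 - (g x + g y)"
      unfolding q_def by (simp add: g.scaleR g.add power_divide) (simp add: field_simps)
    then have "q x + q y = 2 * q ((1/2) *\<^sub>R (x + y)) + (norm (x - y))\<^sup>2 / 2"
      using parallelogram[of x y] by (simp add: q_def[of x] q_def[of y])
    then show ?thesis using m_le[of "(1/2) *\<^sub>R (x + y)"] by simp
  qed
  have "Cauchy X"
  proof (rule metric_CauchyI)
    fix e :: real assume e: "0 < e"
    obtain N where N: "4 / e\<^sup>2 < real N" using reals_Archimedean2 by blast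
    have "dist (X i) (X j) < e" if "i \<ge> N" "j \<ge> N" for i j
    proof -
      have small: "q (X k) - m < e\<^sup>2 / 4" if "k \<ge> N" for k
      proof -
        have "4 / e\<^sup>2 < real (Suc k)" using N that by simp
        then have "1 / real (Suc k) < e\<^sup>2 / 4" using e by (simp add: field_simps)
        with X[of k] show ?thesis by simp
      qed
      have "(norm (X i - X j))\<^sup>2 < e\<^sup>2"
        using q_par[of "X i" "X j"] small[OF that(1)] small[OF that(2)] by simp
      then show ?thesis using e by (simp add: dist_norm power2_less_imp_less)
    qed
    then show "\<exists>M. \<forall>i\<ge>M. \<forall>j\<ge>M. dist (X i) (X j) < e" by blast
  qed
  then obtain z where z: "X \<longlonglongrightarrow> z"
    using Cauchy_convergent_iff convergent_def by blast
  have "(\<lambda>n. q (X n)) \<longlonglongrightarrow> q z"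
    unfolding q_def by (intro tendsto_intros g.tendsto z)
  moreover have "(\<lambda>n. m + 1 / real (Suc n)) \<longlonglongrightarrow> m + 0"
    by (intro tendsto_add tendsto_const LIMSEQ_Suc[OF lim_1_over_n])
  ultimately have "q z \<le> m + 0"
    by (rule LIMSEQ_le) (use X in \<open>auto intro: less_imp_le\<close>)
  then have qz: "q z \<le> m" by simp
  have half: "g x \<le> Re (cinner x z)" for x
  proof (rule ccontr)
    assume "\<not> g x \<le> Re (cinner x z)"
    then have d: "g x - Re (cinner x z) > 0" (is "?d > 0") by simp
    define t where "t = ?d / ((norm x)\<^sup>2 + 1)"
    have den: "(norm x)\<^sup>2 + 1 > 0" by (simp add: add_nonneg_pos)
    have t: "t > 0" unfolding t_def using d den by simp
    have "q (z + t *\<^sub>R x) = q z + t * (t * (norm x)\<^sup>2 - 2 * ?d)"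
      using norm_add_sq[of z "t *\<^sub>R x"] Re_cinner_commute[of z x]
      by (simp add: q_def cinner_scaleR_right g.add g.scaleR power_mult_distrib)
        (simp add: power2_eq_square algebra_simps)
    moreover have "t * (norm x)\<^sup>2 < 2 * ?d"
    proof -
      have "t * (norm x)\<^sup>2 \<le> t * ((norm x)\<^sup>2 + 1)" using t by simp
      also have "\<dots> = ?d" unfolding t_def using den by simp
      finally show ?thesis using d by simp
    qed
    ultimately have "q (z + t *\<^sub>R x) < q z"
      using t by (simp add: mult_pos_neg)
    with m_le[of "z + t *\<^sub>R x"] qz show False by simp
  qed
  have "g x = Re (cinner x z)" for x
    using half[of x] half[of "- x"] by (simp add: g.neg cinner_minus_left)
  then show ?thesis by blast
qed


section \<open>C*-algebras\<close>

text \<open>The zero algebra is not excluded, hence \<^class>\<open>real_normed_algebra\<close> together with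
  \<^class>\<open>monoid_mult\<close> instead of \<^class>\<open>real_normed_algebra_1\<close>.\<close>

class unital_cstar_algebra = complex_normed_vector + real_normed_algebra + monoid_mult + banach +
  fixes star :: "'a \<Rightarrow> 'a"
  assumes mult_scaleC_left: "(c *\<^sub>C a) * b = c *\<^sub>C (a * b)"
    and mult_scaleC_right: "a * (c *\<^sub>C b) = c *\<^sub>C (a * b)"
    and star_star: "star (star a) = a"
    and star_add: "star (a + b) = star a + star b"
    and star_scaleC: "star (c *\<^sub>C a) = cnj c *\<^sub>C star a"
    and star_mult: "star (a * b) = star b * star a"
    and norm_star_mult_self: "norm (star a * a) = (norm a)\<^sup>2"

definition cstar_subalgebra :: "'a :: unital_cstar_algebra set \<Rightarrow> bool" where
  "cstar_subalgebra B \<longleftrightarrow> closed B \<and> complex_vector.subspace B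
     \<and> (\<forall>a\<in>B. \<forall>b\<in>B. a * b \<in> B) \<and> (\<forall>a\<in>B. star a \<in> B)"

definition star_hom_on ::
    "'a :: unital_cstar_algebra set \<Rightarrow> ('a \<Rightarrow> 'b :: unital_cstar_algebra) \<Rightarrow> bool" where
  "star_hom_on B f \<longleftrightarrow>
     (\<forall>a\<in>B. \<forall>b\<in>B. f (a + b) = f a + f b) \<and> (\<forall>c. \<forall>a\<in>B. f (c *\<^sub>C a) = c *\<^sub>C f a)
     \<and> (\<forall>a\<in>B. \<forall>b\<in>B. f (a * b) = f a * f b) \<and> (\<forall>a\<in>B. f (star a) = star (f a))"

definition star_isomorphism ::
    "'a :: unital_cstar_algebra set \<Rightarrow> 'b :: unital_cstar_algebra set \<Rightarrow> ('a \<Rightarrow> 'b) \<Rightarrow> bool" where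
  "star_isomorphism B C f \<longleftrightarrow> star_hom_on B f \<and> bij_betw f B C"

definition cstar_ideal :: "'a :: unital_cstar_algebra set \<Rightarrow> bool" where
  "cstar_ideal J \<longleftrightarrow> closed J \<and> complex_vector.subspace J
     \<and> (\<forall>a. \<forall>j\<in>J. a * j \<in> J \<and> j * a \<in> J)"

definition commutant :: "'a :: times set \<Rightarrow> 'a set" where
  "commutant S = {T. \<forall>s\<in>S. T * s = s * T}"


section \<open>The C*-algebra of bounded operators on a Hilbert space\<close>

typedef (overloaded) 'h bop =
  "{T :: 'h :: chilbert_space \<Rightarrow>\<^sub>L 'h. \<forall>c x. T (c *\<^sub>C x) = c *\<^sub>C T x}"
  morphisms blinfun_of_bop Bop
  by (rule exI[of _ 0]) simp

setup_lifting type_definition_bop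

lift_definition bop_apply :: "'h :: chilbert_space bop \<Rightarrow> 'h \<Rightarrow> 'h" is blinfun_apply .

lemma bop_eqI: "(\<And>x. bop_apply S x = bop_apply T x) \<Longrightarrow> S = T"
  by transfer (rule blinfun_eqI)

lemma bop_apply_scaleC: "bop_apply T (c *\<^sub>C x) = c *\<^sub>C bop_apply T x"
  by transfer simp

lemma bounded_linear_bop_apply: "bounded_linear (bop_apply T)"
  by transfer (rule blinfun.bounded_linear_right)

lemma bop_exI:
  assumes "bounded_linear f" "\<And>c x. f (c *\<^sub>C x) = c *\<^sub>C f x"
  shows "\<exists>T. bop_apply T = f"
  using assms
  by (intro exI[of _ "Bop (Blinfun f)"])
    (simp add: bop_apply.rep_eq Bop_inverse bounded_linear_Blinfun_apply)

instantiation bop :: (chilbert_space) complex_normed_vector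
begin

lift_definition zero_bop :: "'a bop" is 0 by simp
lift_definition plus_bop :: "'a bop \<Rightarrow> 'a bop \<Rightarrow> 'a bop" is "(+)"
  by (simp add: blinfun.add_left scaleC_add_right)
lift_definition uminus_bop :: "'a bop \<Rightarrow> 'a bop" is uminus
  by (simp add: blinfun.minus_left)
lift_definition minus_bop :: "'a bop \<Rightarrow> 'a bop \<Rightarrow> 'a bop" is "(-)"
  by (simp add: blinfun.diff_left complex_vector.scale_right_diff_distrib)
lift_definition scaleR_bop :: "real \<Rightarrow> 'a bop \<Rightarrow> 'a bop" is "(*\<^sub>R)"
  by (simp add: blinfun.scaleR_left scaleC_of_real[symmetric] scaleC_scaleC mult.commute)
lift_definition norm_bop :: "'a bop \<Rightarrow> real" is norm .
lift_definition dist_bop :: "'a bop \<Rightarrow> 'a bop \<Rightarrow> real" is dist .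

definition scaleC_bop :: "complex \<Rightarrow> 'a bop \<Rightarrow> 'a bop" where
  "scaleC_bop c T = (THE S. \<forall>x. bop_apply S x = c *\<^sub>C bop_apply T x)"
definition sgn_bop :: "'a bop \<Rightarrow> 'a bop" where
  "sgn_bop T = inverse (norm T) *\<^sub>R T"
definition uniformity_bop :: "('a bop \<times> 'a bop) filter" where
  "uniformity_bop = (INF e\<in>{0<..}. principal {(S, T). dist S T < e})"
definition open_bop :: "'a bop set \<Rightarrow> bool" where
  "open_bop U \<longleftrightarrow> (\<forall>S\<in>U. \<forall>\<^sub>F (S', T) in uniformity. S' = S \<longrightarrow> T \<in> U)"

lemma bounded_linear_scaleC: "bounded_linear ((*\<^sub>C) c :: 'a \<Rightarrow> 'a)"
proof (rule bounded_linear_intro[where K = "cmod c"])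
  show "c *\<^sub>C (r *\<^sub>R x) = r *\<^sub>R (c *\<^sub>C x)" for r and x :: 'a
    by (simp add: scaleC_of_real[symmetric] scaleC_scaleC mult.commute)
qed (simp_all add: scaleC_add_right norm_scaleC mult.commute)

lemma bop_apply_scaleC_left: "bop_apply (c *\<^sub>C T) x = c *\<^sub>C bop_apply T x" for T :: "'a bop"
proof -
  obtain S where S: "bop_apply S = (\<lambda>x. c *\<^sub>C bop_apply T x)"
    using bop_exI[of "\<lambda>x. c *\<^sub>C bop_apply T x"]
    by (auto simp: bop_apply_scaleC scaleC_scaleC mult.commute
        intro!: bounded_linear_compose[OF bounded_linear_scaleC bounded_linear_bop_apply])
  have "c *\<^sub>C T = S"
    unfolding scaleC_bop_def using S by (intro the_equality) (auto intro: bop_eqI)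
  then show ?thesis by (simp add: S)
qed

lemma bop_apply_add_left: "bop_apply (S + T) x = bop_apply S x + bop_apply T x" for S T :: "'a bop"
  by transfer (simp add: blinfun.add_left)

lemma bop_apply_scaleR_left: "bop_apply (r *\<^sub>R T) x = r *\<^sub>R bop_apply T x" for T :: "'a bop"
  by transfer (simp add: blinfun.scaleR_left)

lemma norm_bop_eq_onorm: "norm T = onorm (bop_apply T)" for T :: "'a bop"
  by transfer (rule norm_blinfun.rep_eq)

lemma norm_scaleC_bop: "norm (c *\<^sub>C T) = cmod c * norm T" for T :: "'a bop"
proof -
  have le: "norm (c *\<^sub>C T) \<le> cmod c * norm T" for c and T :: "'a bop"
    unfolding norm_bop_eq_onorm[of "c *\<^sub>C T"]
  proof (rule onorm_bound)
    show "0 \<le> cmod c * norm T"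
      by (simp add: norm_bop_eq_onorm onorm_pos_le bounded_linear_bop_apply)
    show "norm (bop_apply (c *\<^sub>C T) x) \<le> cmod c * norm T * norm x" for x
      using onorm[OF bounded_linear_bop_apply, of T x]
      by (simp add: bop_apply_scaleC_left norm_scaleC norm_bop_eq_onorm mult.assoc mult_left_mono)
  qed
  show ?thesis
  proof (cases "c = 0")
    case True
    then show ?thesis
      using le[of c T] onorm_pos_le[OF bounded_linear_bop_apply, of "c *\<^sub>C T"]
      by (simp add: norm_bop_eq_onorm)
  next
    case False
    have "inverse c *\<^sub>C c *\<^sub>C T = T"
      by (rule bop_eqI) (simp add: bop_apply_scaleC_left scaleC_scaleC False scaleC_one)
    then have "norm T \<le> inverse (cmod c) * norm (c *\<^sub>C T)"
      using le[of "inverse c" "c *\<^sub>C T"] by (simp add: norm_inverse)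
    then have "cmod c * norm T \<le> norm (c *\<^sub>C T)"
      using False by (simp add: field_simps)
    with le[of c T] show ?thesis by simp
  qed
qed

instance
proof
  fix S T R :: "'a bop" and c d :: complex and r s :: real
  show "S + T + R = S + (T + R)" "S + T = T + S" "0 + S = S" "- S + S = 0" "S - T = S + - T"
    "r *\<^sub>R (S + T) = r *\<^sub>R S + r *\<^sub>R T" "(r + s) *\<^sub>R S = r *\<^sub>R S + s *\<^sub>R S"
    "r *\<^sub>R s *\<^sub>R S = (r * s) *\<^sub>R S" "1 *\<^sub>R S = S"
    by (transfer; simp add: algebra_simps)+
  show "c *\<^sub>C (S + T) = c *\<^sub>C S + c *\<^sub>C T" "(c + d) *\<^sub>C S = c *\<^sub>C S + d *\<^sub>C S"
    "c *\<^sub>C d *\<^sub>C S = (c * d) *\<^sub>C S" "complex_of_real r *\<^sub>C S = r *\<^sub>R S"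
    by (rule bop_eqI; simp add: bop_apply_scaleC_left bop_apply_add_left bop_apply_scaleR_left
        scaleC_add_right scaleC_add_left scaleC_scaleC scaleC_of_real)+
  show "norm (c *\<^sub>C S) = cmod c * norm S" by (rule norm_scaleC_bop)
  show "sgn S = inverse (norm S) *\<^sub>R S" by (rule sgn_bop_def)
  show "dist S T = norm (S - T)" by transfer (rule dist_norm)
  show "(uniformity :: ('a bop \<times> 'a bop) filter) = (INF e\<in>{0<..}. principal {(S, T). dist S T < e})"
    by (rule uniformity_bop_def)
  show "open U \<longleftrightarrow> (\<forall>S\<in>U. \<forall>\<^sub>F (S', T) in uniformity. S' = S \<longrightarrow> T \<in> U)" for U :: "'a bop set"
    by (rule open_bop_def)
  show "norm S = 0 \<longleftrightarrow> S = 0" by transfer simp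
  show "norm (S + T) \<le> norm S + norm T" by transfer (rule norm_triangle_ineq)
  show "norm (r *\<^sub>R S) = \<bar>r\<bar> * norm S" by transfer simp
qed

end

lemma norm_bop_apply: "norm (bop_apply T x) \<le> norm T * norm x"
  using onorm[OF bounded_linear_bop_apply] by (simp add: norm_bop_eq_onorm)

lemma norm_bop_bound:
  "0 \<le> b \<Longrightarrow> (\<And>x. norm (bop_apply T x) \<le> b * norm x) \<Longrightarrow> norm T \<le> b"
  unfolding norm_bop_eq_onorm by (rule onorm_bound)

lemma cadjoint_ex: "\<exists>S. \<forall>x y. cinner (bop_apply T x) y = cinner x (bop_apply S y)"
  for T :: "'h :: chilbert_space bop"
proof -
  interpret T: bounded_linear "bop_apply T" by (rule bounded_linear_bop_apply)
  have "\<exists>z. \<forall>x. cinner (bop_apply T x) y = cinner x z" for y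
  proof -
    have "bounded_linear (\<lambda>x. Re (cinner (bop_apply T x) y))"
    proof (rule bounded_linear_intro[where K = "norm T * norm y"])
      show "norm (Re (cinner (bop_apply T x) y)) \<le> norm x * (norm T * norm y)" for x
      proof -
        have "norm (Re (cinner (bop_apply T x) y)) \<le> norm (bop_apply T x) * norm y"
          using Re_cinner_le[of "bop_apply T x" y] Re_cinner_le[of "- bop_apply T x" y]
          by (simp add: cinner_minus_left)
        also have "\<dots> \<le> (norm T * norm x) * norm y"
          by (intro mult_right_mono norm_bop_apply norm_ge_zero)
        finally show ?thesis by (simp add: ac_simps)
      qed
    qed (simp_all add: T.add T.scaleR cinner_add_left cinner_scaleR_left)
    from riesz_real[OF this] obtain z
      where z: "\<And>x. Re (cinner (bop_apply T x) y) = Re (cinner x z)" by blast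
    have "cinner (bop_apply T x) y = cinner x z" for x
      using z[of x] z[of "\<i> *\<^sub>C x"]
      by (simp add: bop_apply_scaleC cinner_scaleC_left complex_eq_iff)
    then show ?thesis by blast
  qed
  then obtain S where S: "\<And>x y. cinner (bop_apply T x) y = cinner x (S y)" by metis
  have "bounded_linear S"
  proof (rule bounded_linear_intro[where K = "norm T"])
    show "S (x + y) = S x + S y" for x y
      by (rule cinner_eqI) (simp add: S[symmetric] cinner_add_right)
    show "S (r *\<^sub>R x) = r *\<^sub>R S x" for r x
      by (rule cinner_eqI) (simp add: S[symmetric] cinner_scaleR_right)
    show "norm (S y) \<le> norm y * norm T" for y
    proof -
      have "(norm (S y))\<^sup>2 = Re (cinner (bop_apply T (S y)) y)"
        by (simp add: S cinner_self)
      also have "\<dots> \<le> norm (bop_apply T (S y)) * norm y" by (rule Re_cinner_le)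
      also have "\<dots> \<le> (norm T * norm (S y)) * norm y"
        by (intro mult_right_mono norm_bop_apply norm_ge_zero)
      finally have *: "norm (S y) * norm (S y) \<le> norm (S y) * (norm y * norm T)"
        by (simp add: power2_eq_square ac_simps)
      show ?thesis
      proof (cases "S y = 0")
        case False
        then show ?thesis using * by (simp add: mult_le_cancel_left)
      qed simp
    qed
  qed
  moreover have "S (c *\<^sub>C x) = c *\<^sub>C S x" for c x
    by (rule cinner_eqI) (simp add: S[symmetric] cinner_scaleC_right)
  ultimately obtain S' where "bop_apply S' = S" using bop_exI by blast
  then show ?thesis using S by metis
qed

instantiation bop :: (chilbert_space) unital_cstar_algebra
begin

lift_definition one_bop :: "'a bop" is id_blinfun by simp
lift_definition times_bop :: "'a bop \<Rightarrow> 'a bop \<Rightarrow> 'a bop" is "(o\<^sub>L)" by simp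
definition star_bop :: "'a bop \<Rightarrow> 'a bop" where
  "star_bop T = (THE S. \<forall>x y. cinner (bop_apply T x) y = cinner x (bop_apply S y))"

lemma bop_apply_times: "bop_apply (S * T) x = bop_apply S (bop_apply T x)" for S T :: "'a bop"
  by transfer simp

lemma bop_apply_one: "bop_apply 1 x = (x :: 'a)"
  by transfer simp

lemma cinner_star_bop: "cinner (bop_apply T x) y = cinner x (bop_apply (star T) y)" for T :: "'a bop"
proof -
  have "\<exists>!S. \<forall>x y. cinner (bop_apply T x) y = cinner x (bop_apply S y)"
  proof (rule ex_ex1I[OF cadjoint_ex])
    fix S S' :: "'a bop"
    assume S: "\<forall>x y. cinner (bop_apply T x) y = cinner x (bop_apply S y)"
      and S': "\<forall>x y. cinner (bop_apply T x) y = cinner x (bop_apply S' y)"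
    show "S = S'"
      by (intro bop_eqI cinner_eqI) (use S S' in metis)
  qed
  from theI'[OF this] show ?thesis unfolding star_bop_def by blast
qed

lemma star_bop_eqI:
  fixes S T :: "'a bop"
  assumes "\<And>x y. cinner (bop_apply T x) y = cinner x (bop_apply S y)"
  shows "star T = S"
  by (intro bop_eqI cinner_eqI) (simp add: assms[symmetric] cinner_star_bop[symmetric])

lemma norm_times_bop: "norm (S * T) \<le> norm S * norm T" for S T :: "'a bop"
  by transfer (rule norm_blinfun_compose)

lemma norm_bop_sq_le: "(norm T)\<^sup>2 \<le> norm (star T * T)" for T :: "'a bop"
proof -
  have "norm T \<le> sqrt (norm (star T * T))"
  proof (rule norm_bop_bound)
    fix x
    have "(norm (bop_apply T x))\<^sup>2 = Re (cinner x (bop_apply (star T * T) x))"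
      by (simp add: bop_apply_times cinner_star_bop[symmetric] cinner_self)
    also have "\<dots> \<le> norm x * norm (bop_apply (star T * T) x)" by (rule Re_cinner_le)
    also have "\<dots> \<le> norm x * (norm (star T * T) * norm x)"
      by (intro mult_left_mono norm_bop_apply norm_ge_zero)
    also have "\<dots> = (sqrt (norm (star T * T)) * norm x)\<^sup>2"
      by (simp add: power_mult_distrib power2_eq_square)
    finally show "norm (bop_apply T x) \<le> sqrt (norm (star T * T)) * norm x"
      by (rule power2_le_imp_le) simp
  qed simp
  then have "(norm T)\<^sup>2 \<le> (sqrt (norm (star T * T)))\<^sup>2" by (intro power_mono norm_ge_zero)
  then show ?thesis by simp
qed

lemma star_star_bop: "star (star T) = T" for T :: "'a bop"
proof (rule star_bop_eqI)
  show "cinner (bop_apply (star T) x) y = cinner x (bop_apply T y)" for x y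
    using cinner_star_bop[of T y x]
    by (subst (1 2) cinner_commute) simp
qed

lemma norm_star_bop_le: "norm T \<le> norm (star T)" for T :: "'a bop"
proof (cases "T = 0")
  case False
  have "norm T * norm T \<le> norm (star T) * norm T"
    using norm_bop_sq_le[of T] norm_times_bop[of "star T" T] by (simp add: power2_eq_square)
  then show ?thesis using False by simp
qed simp

instance
proof
  fix S T R :: "'a bop" and c :: complex and r :: real
  interpret S: bounded_linear "bop_apply S" by (rule bounded_linear_bop_apply)
  show "S * T * R = S * (T * R)" "1 * S = S" "S * 1 = S"
    by (rule bop_eqI; simp add: bop_apply_times bop_apply_one)+
  show "(S + T) * R = S * R + T * R" "S * (T + R) = S * T + S * R"
    "(r *\<^sub>R S) * T = r *\<^sub>R (S * T)" "S * (r *\<^sub>R T) = r *\<^sub>R (S * T)"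
    "(c *\<^sub>C S) * T = c *\<^sub>C (S * T)" "S * (c *\<^sub>C T) = c *\<^sub>C (S * T)"
    by (rule bop_eqI; simp add: bop_apply_times bop_apply_add_left bop_apply_scaleR_left
        bop_apply_scaleC_left bop_apply_scaleC S.add S.scaleR)+
  show "norm (S * T) \<le> norm S * norm T" by (rule norm_times_bop)
  show "star (star S) = S" by (rule star_star_bop)
  show "star (S + T) = star S + star T" "star (c *\<^sub>C S) = cnj c *\<^sub>C star S"
    "star (S * T) = star T * star S"
    by (rule star_bop_eqI; simp add: bop_apply_times bop_apply_add_left bop_apply_scaleC_left
        cinner_add_left cinner_add_right cinner_scaleC_left cinner_scaleC_right cinner_star_bop)+
  have "norm (star S) \<le> norm S" using norm_star_bop_le[of "star S"] by (simp add: star_star_bop)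
  then have "norm (star S) * norm S \<le> norm S * norm S" by (simp add: mult_right_mono)
  then show "norm (star S * S) = (norm S)\<^sup>2"
    using norm_bop_sq_le[of S] norm_times_bop[of "star S" S] by (simp add: power2_eq_square)
next
  fix X :: "nat \<Rightarrow> 'a bop"
  assume X: "Cauchy X"
  have dist_eq: "dist S T = dist (blinfun_of_bop S) (blinfun_of_bop T)" for S T :: "'a bop"
    by transfer simp
  have "Cauchy (\<lambda>n. blinfun_of_bop (X n))" using X by (simp add: Cauchy_def dist_eq)
  then obtain L where L: "(\<lambda>n. blinfun_of_bop (X n)) \<longlonglongrightarrow> L"
    using Cauchy_convergent_iff convergent_def by blast
  have app: "(\<lambda>n. blinfun_apply (blinfun_of_bop (X n)) x) \<longlonglongrightarrow> blinfun_apply L x" for x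
    by (intro tendsto_intros L)
  have "blinfun_apply L (c *\<^sub>C x) = c *\<^sub>C blinfun_apply L x" for c x
  proof (rule LIMSEQ_unique[OF app])
    show "(\<lambda>n. blinfun_apply (blinfun_of_bop (X n)) (c *\<^sub>C x)) \<longlonglongrightarrow> c *\<^sub>C blinfun_apply L x"
      using bounded_linear.tendsto[OF bounded_linear_scaleC app[of x], of c]
      by (simp add: bop_apply_scaleC[unfolded bop_apply.rep_eq])
  qed
  then have "blinfun_of_bop (Bop L) = L" by (simp add: Bop_inverse)
  then have "X \<longlonglongrightarrow> Bop L" using L by (simp add: tendsto_iff dist_eq)
  then show "convergent X" by (auto simp: convergent_def)
qed

end

text \<open>Isometric on the orthogonal complement of the kernel.\<close>

definition partial_isometry :: "'h :: chilbert_space bop \<Rightarrow> bool" where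
  "partial_isometry U \<longleftrightarrow>
     (\<forall>x. (\<forall>y. bop_apply U y = 0 \<longrightarrow> cinner x y = 0) \<longrightarrow> norm (bop_apply U x) = norm x)"

definition nondegenerate :: "('a \<Rightarrow> 'h :: chilbert_space bop) \<Rightarrow> bool" where
  "nondegenerate \<pi> \<longleftrightarrow> closure (complex_vector.span {bop_apply (\<pi> a) x | a x. True}) = UNIV"


section \<open>Covariant representations\<close>

definition covariant_representation ::
    "('a :: unital_cstar_algebra \<Rightarrow> 'a) \<Rightarrow> ('a \<Rightarrow> 'h :: chilbert_space bop) \<Rightarrow> 'h bop \<Rightarrow> bool" where
  "covariant_representation \<delta> \<pi> U \<longleftrightarrow>
     star_hom_on UNIV \<pi> \<and> inj \<pi> \<and> nondegenerate \<pi> \<and> partial_isometry U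
     \<and> (\<forall>a. U * \<pi> a * star U = \<pi> (\<delta> a)) \<and> star U * U \<in> commutant (range \<pi>)"

definition associated_with_ideal ::
    "('a \<Rightarrow> 'h :: chilbert_space bop) \<Rightarrow> 'h bop \<Rightarrow> 'a set \<Rightarrow> bool" where
  "associated_with_ideal \<pi> U J \<longleftrightarrow> J = {a. star U * U * \<pi> a = \<pi> a}"

definition finite_matrices :: "('a :: unital_cstar_algebra \<Rightarrow> 'a) \<Rightarrow> (nat \<Rightarrow> nat \<Rightarrow> 'a) set" where
  "finite_matrices \<delta> =
     {a. (\<forall>m n. \<exists>b. a m n = (\<delta> ^^ m) 1 * b * (\<delta> ^^ n) 1) \<and> finite {(m, n). a m n \<noteq> 0}}"

text \<open>The sums over all indices are written as finite sums over the support of the matrix; the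
  omitted terms vanish because \<open>\<pi>\<close> is linear.\<close>

definition property_star ::
    "('a :: unital_cstar_algebra \<Rightarrow> 'a) \<Rightarrow> ('a \<Rightarrow> 'h :: chilbert_space bop) \<Rightarrow> 'h bop \<Rightarrow> bool" where
  "property_star \<delta> \<pi> U \<longleftrightarrow>
     (\<forall>a \<in> finite_matrices \<delta>.
        norm (\<Sum>m\<in>{m. a m m \<noteq> 0}. star U ^ m * \<pi> (a m m) * U ^ m)
        \<le> norm (\<Sum>(m, n)\<in>{(m, n). a m n \<noteq> 0}. star U ^ m * \<pi> (a m n) * U ^ n))"

definition cstar_generated ::
    "('a \<Rightarrow> 'h :: chilbert_space bop) \<Rightarrow> 'h bop \<Rightarrow> 'h bop set" where
  "cstar_generated \<pi> U = cstar_subalgebra hull (insert U (range \<pi>))"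

end

theory Submission imports Defs
begin

text \<open>The relation \<open>U \<pi>(a) = \<pi>(\<delta>(a)) U\<close> and its adjoint turn a product of two expressions
  \<open>U*\<^sup>m \<pi>(a) U\<^sup>n\<close> into a third one, whose exponents and coefficient are computed from
  those of the factors by means of \<open>\<delta>\<close>. So
  the finite sums of such expressions form a dense *-subalgebra of the generated C*-algebra, and its
  operations can be carried out on formal words, that is, on lists of triples \<open>(m, a, n)\<close>. The same
  word can be evaluated in both representations, and an isomorphism as required exists as soon as the
  two values of every word have the same norm (\<open>exists_star_isomorphism_of_val\<close>). That equality is
  proved in two steps.

  Diagonal words (\<open>m = n\<close> throughout, \<open>norm_val_diagonal_word_le\<close>). The projections \<open>U*\<^sup>k U\<^sup>k\<close> decrease
  in \<open>k\<close> and commute with the value of a diagonal word, so its norm is the largest of the norms on the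
  gaps between consecutive projections and on the last of the projections considered. Up to
  conjugation by a power of \<open>U\<close> that preserves norms, the value is \<open>\<pi>(b)(1 - U* U)\<close> on a gap and
  \<open>\<pi>(b)\<close> on the last projection, with a coefficient \<open>b\<close> determined by the word
  and \<open>\<delta>\<close>. The *-homomorphisms \<open>\<pi>(\<cdot>)(1 - U* U)\<close> and \<open>\<pi>\<close> have the kernels \<open>J\<close> and \<open>0\<close> in both
  representations, and the norm of the image under a *-homomorphism depends only on the kernel
  (\<open>norm_star_hom_le_of_kernel_subset\<close>).

  Arbitrary words (\<open>norm_val_le_other_representation\<close>). Grade the monomials by \<open>n - m\<close>. Let \<open>x\<close> and \<open>y\<close>
  be the values of a word in the first and in the second representation, and let the grades of the word
  lie between \<open>- d\<close> and \<open>d\<close>. Splitting \<open>x\<close> into \<open>2 d + 1\<close> homogeneous summands and using the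
  Cauchy-Schwarz inequality bounds \<open>\<parallel>x\<parallel>\<^sup>2\<close> by \<open>2 d + 1\<close> times the norm of the diagonal part of \<open>x x*\<close>.
  This is a diagonal word, so the same bound holds with the diagonal part of \<open>y y*\<close>, and \<open>property_star\<close>
  of the second representation gives \<open>\<parallel>x\<parallel>\<^sup>2 \<le> (2 d + 1) \<parallel>y\<parallel>\<^sup>2\<close>. Applied to the powers
  \<open>(x* x)\<^sup>p\<close>, whose grades grow only linearly in \<open>p\<close>, the factor disappears after taking roots, and
  \<open>\<parallel>x\<parallel> \<le> \<parallel>y\<parallel>\<close>. Exchanging the representations gives equality.

  Uniqueness holds because *-homomorphisms into the bounded operators are automatically contractive
  (\<open>norm_star_hom_on_le\<close>), hence determined by their values on generators. Both facts on
  *-homomorphisms rest on square roots in C*-algebras, which the binomial series provides.\<close>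

section \<open>Elementary facts on C*-algebras\<close>

lemma star_zero [simp]: "star (0 :: 'a :: unital_cstar_algebra) = 0"
  using star_add[of "0 :: 'a" 0] by simp

lemma star_minus: "star (- a :: 'a :: unital_cstar_algebra) = - star a"
  using star_add[of a "- a"] by (simp add: eq_neg_iff_add_eq_0 add.commute)

lemma star_diff: "star (a - b :: 'a :: unital_cstar_algebra) = star a - star b"
  using star_add[of a "- b"] by (simp add: star_minus)

lemma star_one [simp]: "star (1 :: 'a :: unital_cstar_algebra) = 1"
  using star_mult[of "star (1 :: 'a)" 1] by (simp add: star_star)

lemma star_scaleR: "star (r *\<^sub>R a :: 'a :: unital_cstar_algebra) = r *\<^sub>R star a"
  by (simp add: scaleC_of_real[symmetric] star_scaleC)

lemma star_power: "star (a ^ n :: 'a :: unital_cstar_algebra) = star a ^ n"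
  by (induction n) (simp_all add: star_mult power_commutes)

lemma norm_star [simp]: "norm (star a) = norm (a :: 'a :: unital_cstar_algebra)"
proof -
  have le: "norm b \<le> norm (star b)" for b :: 'a
  proof (cases "b = 0")
    case False
    have "norm b * norm b \<le> norm (star b) * norm b"
      using norm_star_mult_self[of b] norm_mult_ineq[of "star b" b] by (simp add: power2_eq_square)
    then show ?thesis using False by simp
  qed simp
  show ?thesis using le[of a] le[of "star a"] by (simp add: star_star)
qed

lemma norm_mult_star_self: "norm (a * star a) = (norm (a :: 'a :: unital_cstar_algebra))\<^sup>2"
  using norm_star_mult_self[of "star a"] by (simp add: star_star)

lemma norm_projection_le:
  fixes p :: "'a :: unital_cstar_algebra"
  assumes "star p = p" "p * p = p"
  shows "norm p \<le> 1"
proof -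
  have "norm p = norm p * norm p"
    using norm_star_mult_self[of p] by (simp add: assms power2_eq_square)
  then show ?thesis by (cases "norm p = 0") auto
qed

lemma norm_partial_isometry_le:
  fixes u :: "'a :: unital_cstar_algebra"
  assumes "u * star u * u = u"
  shows "norm u \<le> 1"
proof -
  have "norm (star u * u) \<le> 1"
    by (rule norm_projection_le) (simp_all add: star_mult star_star mult.assoc assms[unfolded mult.assoc])
  then show ?thesis
    by (simp add: norm_star_mult_self abs_square_le_1)
qed

lemma norm_one_le: "norm (1 :: 'a :: unital_cstar_algebra) \<le> 1"
  by (rule norm_projection_le) simp_all

lemma norm_power_le: "norm (a ^ n) \<le> norm (a :: 'a :: unital_cstar_algebra) ^ n"
proof (induction n)
  case (Suc n)
  have "norm (a ^ Suc n) \<le> norm a * norm (a ^ n)" by (simp add: norm_mult_ineq)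
  also have "\<dots> \<le> norm a * norm a ^ n" by (intro mult_left_mono Suc norm_ge_zero)
  finally show ?case by simp
qed (simp add: norm_one_le)

lemma bounded_linear_star: "bounded_linear (star :: 'a \<Rightarrow> 'a :: unital_cstar_algebra)"
  by (rule bounded_linear_intro[where K = 1]) (simp_all add: star_add star_scaleR)

section \<open>Square roots\<close>

text \<open>The Taylor coefficients of \<open>\<lambda>x. sqrt (1 - x)\<close> at \<open>0\<close>.\<close>

definition sqrt_coeff :: "nat \<Rightarrow> real" where
  "sqrt_coeff k = (- 1) ^ k * ((1/2) gchoose k)"

lemma sqrt_coeff_0 [simp]: "sqrt_coeff 0 = 1"
  by (simp add: sqrt_coeff_def)

lemma gbinomial_Suc_ratio: "(a gchoose Suc k) = (a gchoose k) * ((a - real k) / real (Suc k))"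
proof -
  have "real (Suc k) * (a gchoose Suc k) = (a gchoose k) * (a - real k)"
    using gbinomial_mult_1[of a k] by (simp only: algebra_simps)
  then show ?thesis by (simp add: eq_divide_eq mult.commute del: of_nat_Suc)
qed

lemma sqrt_coeff_Suc: "sqrt_coeff (Suc k) = sqrt_coeff k * ((real k - 1/2) / real (Suc k))"
proof -
  have "(real k - 1/2) / real (Suc k) = - ((1/2 - real k) / real (Suc k))"
    by (simp only: minus_divide_left minus_diff_eq)
  then show ?thesis unfolding sqrt_coeff_def gbinomial_Suc_ratio[of _ k] by simp
qed

lemma sqrt_coeff_Suc_nonpos: "sqrt_coeff (Suc k) \<le> 0"
proof (induction k)
  case 0
  show ?case by (simp add: sqrt_coeff_Suc)
next
  case (Suc k)
  then show ?case
    unfolding sqrt_coeff_Suc[of "Suc k"] by (intro mult_nonpos_nonneg divide_nonneg_nonneg) auto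
qed

text \<open>The alternating partial sums of a binomial row telescope. Since all coefficients but the first are
  nonpositive, this makes the binomial series converge absolutely on the whole closed unit disc, where a
  comparison with the geometric series would fail.\<close>

lemma sum_sqrt_coeff_nonneg: "0 \<le> (\<Sum>k\<le>n. sqrt_coeff k)"
proof -
  have "(\<Sum>k\<le>n. sqrt_coeff k) = (- 1) ^ n * ((- 1/2) gchoose n)"
    using gbinomial_sum_lower_neg[of "1/2::real" n] by (simp add: sqrt_coeff_def mult.commute)
  also have "\<dots> \<ge> 0"
  proof (induction n)
    case (Suc n)
    have "(- 1) ^ Suc n * ((- 1/2 :: real) gchoose Suc n)
        = ((- 1) ^ n * ((- 1/2) gchoose n)) * ((real n + 1/2) / real (Suc n))"
    proof -
      have "(real n + 1/2) / real (Suc n) = - ((- 1/2 - real n) / real (Suc n))"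
        by (simp only: minus_divide_left minus_diff_eq) simp
      then show ?thesis unfolding gbinomial_Suc_ratio[of _ n] by simp
    qed
    also have "\<dots> \<ge> 0" by (rule mult_nonneg_nonneg[OF Suc]) simp
    finally show ?case .
  qed simp
  finally show ?thesis .
qed

lemma sum_sqrt_coeff_tail_le: "(\<Sum>k<n. \<bar>sqrt_coeff (Suc k)\<bar>) \<le> 1"
proof -
  have "(\<Sum>k<n. \<bar>sqrt_coeff (Suc k)\<bar>) = 1 - (\<Sum>k\<le>n. sqrt_coeff k)"
  proof -
    have "(\<Sum>k\<le>n. sqrt_coeff k) = 1 + (\<Sum>k<n. sqrt_coeff (Suc k))"
      by (induction n) simp_all
    then show ?thesis using sqrt_coeff_Suc_nonpos by (simp add: abs_of_nonpos sum_negf)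
  qed
  then show ?thesis using sum_sqrt_coeff_nonneg[of n] by simp
qed

lemma sqrt_coeff_convolution:
  "(\<Sum>i\<le>n. sqrt_coeff i * sqrt_coeff (n - i)) = (if n = 0 then 1 else if n = 1 then - 1 else 0)"
proof -
  have "(\<Sum>i\<le>n. sqrt_coeff i * sqrt_coeff (n - i))
      = (- 1) ^ n * (\<Sum>i\<in>{0..n}. ((1/2::real) gchoose i) * ((1/2) gchoose (n - i)))"
    unfolding sum_distrib_left atMost_atLeast0
  proof (rule sum.cong[OF refl])
    fix i assume "i \<in> {0..n}"
    then have "(- 1 :: real) ^ n = (- 1) ^ i * (- 1) ^ (n - i)" by (simp flip: power_add)
    then show "sqrt_coeff i * sqrt_coeff (n - i)
        = (- 1) ^ n * (((1/2::real) gchoose i) * ((1/2) gchoose (n - i)))"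
      by (simp add: sqrt_coeff_def)
  qed
  also have "\<dots> = (- 1) ^ n * ((1 :: real) gchoose n)"
    using gbinomial_Vandermonde[of "1/2::real" "1/2" n] by simp
  also have "(1 :: real) gchoose n = of_nat (1 choose n)"
    using binomial_gbinomial[of 1 n, where 'a = real] by simp
  finally show ?thesis by (cases n) (auto simp: binomial_eq_0)
qed

text \<open>Closure under the involution is left out so that the centralizer of an arbitrary element qualifies.
  Membership in all such algebras then says at once that a root commutes with whatever its argument
  commutes with, and that it stays inside any given C*-subalgebra with unit.\<close>

definition closed_unital_subalgebra :: "'a :: unital_cstar_algebra set \<Rightarrow> bool" where
  "closed_unital_subalgebra C \<longleftrightarrow> closed C \<and> complex_vector.subspace C \<and> 1 \<in> C
     \<and> (\<forall>a\<in>C. \<forall>b\<in>C. a * b \<in> C)"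

lemma closed_unital_subalgebra_centralizer: "closed_unital_subalgebra {a. t * a = a * t}"
proof -
  have "closed {a. t * a = a * t}"
    by (intro closed_Collect_eq continuous_intros)
  then show ?thesis
    unfolding closed_unital_subalgebra_def complex_vector.subspace_def
    by (auto simp: algebra_simps mult_scaleC_left mult_scaleC_right) (metis mult.assoc)
qed

text \<open>The root is the sum of the binomial series. The bound on \<open>1 - s\<close> says that \<open>s\<close> itself is again of the
  form \<open>1 - x'\<close> with \<open>\<parallel>x'\<parallel> \<le> 1\<close>, so that roots can be taken repeatedly.\<close>

lemma exists_sqrt_one_minus:
  fixes x :: "'a :: unital_cstar_algebra"
  assumes sa: "star x = x" and le: "norm x \<le> 1"
  shows "\<exists>s. star s = s \<and> s * s = 1 - x \<and> norm (1 - s) \<le> 1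
     \<and> (\<forall>C. closed_unital_subalgebra C \<longrightarrow> x \<in> C \<longrightarrow> s \<in> C)"
proof -
  define f where "f k = sqrt_coeff k *\<^sub>R x ^ k" for k
  define s where "s = suminf f"
  have pow: "norm (x ^ k) \<le> 1" for k
    using norm_power_le[of x k] power_le_one[OF norm_ge_zero le, of k] by simp
  have nf: "norm (f k) \<le> \<bar>sqrt_coeff k\<bar>" for k
    using mult_left_mono[OF pow[of k], of "\<bar>sqrt_coeff k\<bar>"] by (simp add: f_def)
  have summ_c: "summable (\<lambda>k. \<bar>sqrt_coeff (Suc k)\<bar>)"
    by (rule summableI_nonneg_bounded[OF _ sum_sqrt_coeff_tail_le]) simp
  have summ_nSuc: "summable (\<lambda>k. norm (f (Suc k)))"
    by (rule summable_comparison_test'[OF summ_c, of 0]) (simp add: nf)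
  then have summ_n: "summable (\<lambda>k. norm (f k))"
    using summable_Suc_iff[of "\<lambda>k. norm (f k)"] by simp
  then have summ: "summable f" by (rule summable_norm_cancel)
  have "star s = s"
  proof -
    have "star s = (\<Sum>k. star (f k))"
      unfolding s_def by (rule bounded_linear.suminf[OF bounded_linear_star summ])
    also have "(\<lambda>k. star (f k)) = f"
      by (simp add: f_def star_scaleR star_power sa fun_eq_iff)
    finally show ?thesis by (simp add: s_def)
  qed
  moreover have "s * s = 1 - x"
  proof -
    have "(\<lambda>n. \<Sum>i\<le>n. f i * f (n - i)) sums (s * s)"
      unfolding s_def by (rule Cauchy_product_sums[OF summ_n summ_n])
    moreover have "(\<Sum>i\<le>n. f i * f (n - i)) = (if n = 0 then 1 else if n = 1 then - x else 0)" for n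
    proof -
      have "(\<Sum>i\<le>n. f i * f (n - i)) = (\<Sum>i\<le>n. (sqrt_coeff i * sqrt_coeff (n - i)) *\<^sub>R x ^ n)"
        by (intro sum.cong) (auto simp: f_def simp flip: power_add)
      also have "\<dots> = (\<Sum>i\<le>n. sqrt_coeff i * sqrt_coeff (n - i)) *\<^sub>R x ^ n"
        by (simp add: scaleR_sum_left)
      also have "\<dots> = (if n = 0 then 1 else if n = 1 then - x else 0)"
        unfolding sqrt_coeff_convolution by auto
      finally show ?thesis .
    qed
    ultimately have 1: "(\<lambda>n::nat. if n = 0 then 1 else if n = 1 then - x else 0) sums (s * s)"
      by (simp only:)
    have 2: "(\<lambda>n::nat. if n = 0 then 1 else if n = 1 then - x else 0) sums
        (\<Sum>n\<in>{0,1::nat}. if n = 0 then 1 else if n = 1 then - x else 0)"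
      by (rule sums_finite) auto
    show ?thesis using sums_unique2[OF 1 2] by simp
  qed
  moreover have "norm (1 - s) \<le> 1"
  proof -
    have "1 - s = - (\<Sum>k. f (Suc k))"
      using suminf_split_head[OF summ] by (simp add: s_def f_def)
    then have "norm (1 - s) = norm (\<Sum>k. f (Suc k))" by (simp add: norm_minus_cancel)
    also have "\<dots> \<le> (\<Sum>k. norm (f (Suc k)))" by (rule summable_norm[OF summ_nSuc])
    also have "\<dots> \<le> (\<Sum>k. \<bar>sqrt_coeff (Suc k)\<bar>)"
      by (rule suminf_le[OF _ summ_nSuc summ_c]) (rule nf)
    also have "\<dots> \<le> 1" by (rule suminf_le_const[OF summ_c sum_sqrt_coeff_tail_le])
    finally show ?thesis .
  qed
  moreover have "s \<in> C" if C: "closed_unital_subalgebra C" and x: "x \<in> C" for C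
  proof -
    have sub: "complex_vector.subspace C" and cl: "closed C"
      using C by (auto simp: closed_unital_subalgebra_def)
    have "x ^ k \<in> C" for k
      by (induction k) (use C x in \<open>auto simp: closed_unital_subalgebra_def\<close>)
    then have "f k \<in> C" for k
      unfolding f_def scaleC_of_real[symmetric] using sub by (rule complex_vector.subspace_scale[rotated])
    then have "(\<Sum>k<n. f k) \<in> C" for n
      using sub by (intro complex_vector.subspace_sum) auto
    moreover have "(\<lambda>n. \<Sum>k<n. f k) \<longlonglongrightarrow> s"
      unfolding s_def by (rule summable_LIMSEQ[OF summ])
    ultimately show ?thesis by (rule closed_sequentially[OF cl])
  qed
  ultimately show ?thesis by blast
qed

text \<open>By spectral theory \<open>1 - h\<^sup>2\<close> lies between \<open>0\<close> and \<open>1\<close>. Without a spectrum: \<open>1 - h\<^sup>2\<close> is the square of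
  the imaginary part of the unitary \<open>h + \<i> sqrt (1 - h\<^sup>2)\<close>, and the imaginary part of a
  contraction is a contraction.\<close>

lemma norm_one_minus_square_le:
  fixes h :: "'a :: unital_cstar_algebra"
  assumes sa: "star h = h" and le: "norm h \<le> 1"
  shows "norm (1 - h * h) \<le> 1"
proof -
  have hh: "star (h * h) = h * h" "norm (h * h) \<le> 1"
    using norm_star_mult_self[of h] le by (simp_all add: sa star_mult power_le_one)
  obtain s where s: "star s = s" "s * s = 1 - h * h"
    and C: "\<And>C. closed_unital_subalgebra C \<Longrightarrow> h * h \<in> C \<Longrightarrow> s \<in> C"
    using exists_sqrt_one_minus[OF hh] by blast
  have comm: "h * s = s * h"
    using C[OF closed_unital_subalgebra_centralizer[of h]] by (simp add: mult.assoc)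
  define u where "u = h + \<i> *\<^sub>C s"
  have "star u * u = h * h + s * s"
    by (simp add: u_def star_add star_scaleC sa s(1) algebra_simps mult_scaleC_left
        mult_scaleC_right scaleC_scaleC comm scaleC_one complex_vector.scale_minus_left)
  then have "star u * u = 1" by (simp add: s(2))
  then have "(norm u)\<^sup>2 \<le> 1"
    using norm_star_mult_self[of u] norm_one_le[where 'a = 'a] by simp
  then have u: "norm u \<le> 1" by (simp add: abs_square_le_1)
  have "(2 * \<i>) *\<^sub>C s = u - star u"
    by (simp add: u_def star_add star_scaleC sa s(1) complex_vector.scale_minus_left
        flip: scaleC_add_left)
  then have "norm ((2 * \<i>) *\<^sub>C s) \<le> norm u + norm (star u)"
    using norm_triangle_ineq4[of u "star u"] by simp
  then have "norm s \<le> 1" using u by (simp add: norm_scaleC norm_mult)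
  then show ?thesis
    using norm_star_mult_self[of s] s by (simp add: power_le_one)
qed

text \<open>Here \<open>z * z\<close> is the absolute value of \<open>h\<close>; returning its root \<open>z\<close> instead of the absolute value
  makes the positivity of \<open>z * z\<close> visible to every *-homomorphism. After rescaling, \<open>h\<^sup>2 = 1 - (1 - h\<^sup>2)\<close>
  with \<open>\<parallel>1 - h\<^sup>2\<parallel> \<le> 1\<close>, and two applications of the binomial series produce the fourth root.\<close>

lemma exists_sqrt_abs:
  fixes h :: "'a :: unital_cstar_algebra"
  assumes sa: "star h = h"
  shows "\<exists>z. star z = z \<and> (z * z) * (z * z) = h * h \<and> h * z = z * h"
proof (cases "h = 0")
  case True
  then show ?thesis by (intro exI[of _ 0]) simp
next
  case False
  define r where "r = norm h"
  define k where "k = inverse r *\<^sub>R h"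
  have r: "r > 0" using False by (simp add: r_def)
  have k: "star k = k" "norm k \<le> 1"
    using r by (simp_all add: k_def star_scaleR sa r_def)
  have "star (1 - k * k) = 1 - k * k" by (simp add: star_diff star_mult k)
  from exists_sqrt_one_minus[OF this norm_one_minus_square_le[OF k]]
  obtain y where y: "star y = y" "y * y = k * k" "norm (1 - y) \<le> 1"
    and yC: "\<And>C. closed_unital_subalgebra C \<Longrightarrow> 1 - k * k \<in> C \<Longrightarrow> y \<in> C"
    by auto
  have "star (1 - y) = 1 - y" by (simp add: star_diff y)
  from exists_sqrt_one_minus[OF this y(3)]
  obtain z where z: "star z = z" "z * z = y"
    and zC: "\<And>C. closed_unital_subalgebra C \<Longrightarrow> 1 - y \<in> C \<Longrightarrow> z \<in> C"
    by auto
  have ky: "k * y = y * k"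
    using yC[OF closed_unital_subalgebra_centralizer[of k]] by (simp add: algebra_simps)
  have kz: "k * z = z * k"
    using zC[OF closed_unital_subalgebra_centralizer[of k]] by (simp add: algebra_simps ky)
  have h: "h = r *\<^sub>R k" using r by (simp add: k_def)
  define z' where "z' = sqrt r *\<^sub>R z"
  have "z' * z' = r *\<^sub>R y" using r by (simp add: z'_def z)
  then have "(z' * z') * (z' * z') = h * h" by (simp add: y h)
  moreover have "star z' = z'" "h * z' = z' * h"
    by (simp_all add: z'_def star_scaleR z h kz)
  ultimately show ?thesis by blast
qed

section \<open>Star-homomorphisms into operators\<close>

lemma bop_apply_zero_right [simp]: "bop_apply T 0 = 0"
  by (rule linear_0[OF bounded_linear.linear[OF bounded_linear_bop_apply]])

lemma bop_apply_add_right: "bop_apply T (x + y) = bop_apply T x + bop_apply T y"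
  by (rule linear_add[OF bounded_linear.linear[OF bounded_linear_bop_apply]])

lemma bop_apply_zero_left [simp]: "bop_apply 0 x = 0"
  using bop_apply_add_left[of 0 0 x] by simp

lemma bop_apply_diff_left: "bop_apply (S - T) x = bop_apply S x - bop_apply T x"
  using bop_apply_add_left[of "S - T" T x] by (simp add: eq_diff_eq)

lemma norm_bop_apply_sq:
  "(norm (bop_apply T x))\<^sup>2 = Re (cinner (bop_apply (star T * T) x) x)"
proof -
  have "(norm (bop_apply T x))\<^sup>2 = Re (cinner (bop_apply T x) (bop_apply T x))"
    by (simp add: cinner_self)
  also have "\<dots> = Re (cinner x (bop_apply (star T * T) x))"
    by (simp only: cinner_star_bop bop_apply_times)
  also have "\<dots> = Re (cinner (bop_apply (star T * T) x) x)"
    by (rule Re_cinner_commute)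
  finally show ?thesis .
qed

lemma norm_bop_sq_boundI:
  assumes "0 \<le> c" "\<And>x. (norm (bop_apply T x))\<^sup>2 \<le> c * (norm x)\<^sup>2"
  shows "(norm T)\<^sup>2 \<le> c"
proof -
  have "norm T \<le> sqrt c"
  proof (rule norm_bop_bound)
    fix x
    have "(norm (bop_apply T x))\<^sup>2 \<le> (sqrt c * norm x)\<^sup>2"
      using assms by (simp add: power_mult_distrib)
    then show "norm (bop_apply T x) \<le> sqrt c * norm x"
      by (rule power2_le_imp_le) (simp add: assms)
  qed (simp add: assms)
  then have "(norm T)\<^sup>2 \<le> (sqrt c)\<^sup>2" by (intro power_mono norm_ge_zero)
  then show ?thesis by (simp add: assms)
qed

lemma star_hom_on_simps:
  assumes "star_hom_on B f"
  shows star_hom_on_add: "a \<in> B \<Longrightarrow> b \<in> B \<Longrightarrow> f (a + b) = f a + f b"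
    and star_hom_on_scaleC: "a \<in> B \<Longrightarrow> f (c *\<^sub>C a) = c *\<^sub>C f a"
    and star_hom_on_scaleR: "a \<in> B \<Longrightarrow> f (r *\<^sub>R a) = r *\<^sub>R f a"
    and star_hom_on_mult: "a \<in> B \<Longrightarrow> b \<in> B \<Longrightarrow> f (a * b) = f a * f b"
    and star_hom_on_star: "a \<in> B \<Longrightarrow> f (star a) = star (f a)"
    and star_hom_on_zero: "0 \<in> B \<Longrightarrow> f 0 = 0"
    and star_hom_on_minus: "a \<in> B \<Longrightarrow> f (- a) = - f a"
proof -
  have C: "f (c *\<^sub>C a) = c *\<^sub>C f a" if "a \<in> B" for a c
    using assms that by (simp add: star_hom_on_def)
  have R: "f (r *\<^sub>R a) = r *\<^sub>R f a" if "a \<in> B" for a r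
    using C[OF that, of "of_real r"] by (simp add: scaleC_of_real)
  show "a \<in> B \<Longrightarrow> f (c *\<^sub>C a) = c *\<^sub>C f a" "a \<in> B \<Longrightarrow> f (r *\<^sub>R a) = r *\<^sub>R f a"
    using C R by auto
  show "0 \<in> B \<Longrightarrow> f 0 = 0"
    using R[of 0 0] by simp
  show "a \<in> B \<Longrightarrow> f (- a) = - f a"
    using R[of a "-1"] by simp
qed (use assms in \<open>simp_all add: star_hom_on_def\<close>)

lemma star_hom_diff:
  assumes "star_hom_on UNIV f"
  shows "f (a - b) = f a - f b"
  using star_hom_on_simps(1)[OF assms, of a "- b"] star_hom_on_simps(7)[OF assms, of b] by simp

lemma star_hom_on_UNIV_unit:
  assumes "star_hom_on UNIV f"
  shows "star (f 1) = f 1" "f 1 * f 1 = f 1" "f 1 * f a = f a" "f a * f 1 = f a"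
  using star_hom_on_simps(5)[OF assms, of 1] star_hom_on_simps(4)[OF assms, of 1 1]
    star_hom_on_simps(4)[OF assms, of 1 a] star_hom_on_simps(4)[OF assms, of a 1]
  by simp_all

text \<open>The usual functional calculus argument with \<open>t \<mapsto> max 0 (t - \<alpha>)\<close>, stripped to algebra. For \<open>a = w* w\<close> and
  \<open>\<alpha> = \<parallel>f a\<parallel>\<close>, twice the positive part of \<open>h = a - \<alpha>\<close> is \<open>\<bar>h\<bar> + h\<close>. It is annihilated by \<open>f\<close>
  because \<open>f h \<le> 0\<close>, hence it is annihilated by \<open>g\<close>, hence \<open>g a \<le> \<alpha>\<close>.\<close>

lemma norm_star_hom_le_of_kernel_subset:
  fixes f :: "'a :: unital_cstar_algebra \<Rightarrow> 'h\<^sub>1 :: chilbert_space bop"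
    and g :: "'a \<Rightarrow> 'h\<^sub>2 :: chilbert_space bop"
  assumes f: "star_hom_on UNIV f" and g: "star_hom_on UNIV g"
    and ker: "\<And>a. f a = 0 \<Longrightarrow> g a = 0"
  shows "norm (g w) \<le> norm (f w)"
proof -
  note fs = star_hom_on_simps[OF f, simplified] star_hom_diff[OF f]
  note gs = star_hom_on_simps[OF g, simplified] star_hom_diff[OF g]
  define a where "a = star w * w"
  define \<alpha> where "\<alpha> = norm (f a)"
  define h where "h = a - \<alpha> *\<^sub>R 1"
  have "star h = h" by (simp add: h_def a_def star_diff star_mult star_star star_scaleR)
  from exists_sqrt_abs[OF this] obtain z
    where z: "star z = z" "(z * z) * (z * z) = h * h" "h * z = z * h" by blast
  have zh: "z * z * h = h * (z * z)" using z(3) by (metis mult.assoc)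
  define D where "D = f (z * z + h)"
  have prod: "(z * z - h) * (z * z + h) = 0"
    using z(2) zh by (simp add: algebra_simps)
  \<comment> \<open>On the range of \<open>D\<close> the positive operators \<open>f \<bar>h\<bar>\<close> and \<open>- f h\<close> add up to 0, so both vanish there.\<close>
  have "bop_apply (D * D) \<xi> = 0" for \<xi>
  proof -
    define \<eta> where "\<eta> = bop_apply D \<xi>"
    have e: "bop_apply (f 1) \<eta> = \<eta>"
      using star_hom_on_UNIV_unit(3)[OF f, of "z * z + h"]
      by (simp add: \<eta>_def D_def flip: bop_apply_times)
    have hz: "f h = f a - \<alpha> *\<^sub>R f 1" by (simp add: h_def fs)
    have eq: "bop_apply (f (z * z)) \<eta> = bop_apply (f h) \<eta>"
    proof -
      have "bop_apply (f (z * z - h)) \<eta> = 0"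
        by (simp add: \<eta>_def D_def prod fs(4)[symmetric] fs(6) flip: bop_apply_times)
      then show ?thesis by (simp only: fs(8) bop_apply_diff_left) simp
    qed
    have "(norm (bop_apply (f z) \<eta>))\<^sup>2 = Re (cinner (bop_apply (f (z * z)) \<eta>) \<eta>)"
      by (simp add: norm_bop_apply_sq fs(4) z(1) flip: fs(5))
    also have "\<dots> = Re (cinner (bop_apply (f a) \<eta>) \<eta>) - \<alpha> * (norm \<eta>)\<^sup>2"
      by (simp add: eq hz bop_apply_diff_left bop_apply_scaleR_left e cinner_diff_left
          cinner_scaleR_left cinner_self)
    also have "\<dots> \<le> 0"
    proof -
      have "Re (cinner (bop_apply (f a) \<eta>) \<eta>) \<le> norm (bop_apply (f a) \<eta>) * norm \<eta>"
        by (rule Re_cinner_le)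
      also have "\<dots> \<le> (\<alpha> * norm \<eta>) * norm \<eta>"
        unfolding \<alpha>_def by (intro mult_right_mono norm_bop_apply norm_ge_zero)
      finally show ?thesis by (simp add: power2_eq_square)
    qed
    finally have "bop_apply (f z) \<eta> = 0" by simp
    then have "bop_apply (f (z * z)) \<eta> = 0" by (simp add: fs(4) bop_apply_times)
    then have "bop_apply D \<eta> = 0" unfolding D_def fs(1) bop_apply_add_left using eq by simp
    then show ?thesis by (simp add: bop_apply_times \<eta>_def)
  qed
  then have "D * D = 0" by (intro bop_eqI) simp
  moreover have "star D = D"
    by (simp add: D_def star_add star_mult z(1) \<open>star h = h\<close> flip: fs(5))
  ultimately have "D = 0" using norm_star_mult_self[of D] by simp
  then have "g (z * z + h) = 0" unfolding D_def by (rule ker)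
  then have ga: "g a = \<alpha> *\<^sub>R g 1 - g (z * z)"
    by (simp add: h_def gs algebra_simps)
  have "(norm (g w))\<^sup>2 \<le> \<alpha>"
  proof (rule norm_bop_sq_boundI)
    show "0 \<le> \<alpha>" by (simp add: \<alpha>_def)
    fix \<xi>
    have gsq: "(norm (bop_apply (g b) \<xi>))\<^sup>2 = Re (cinner (bop_apply (g (star b * b)) \<xi>) \<xi>)" for b
      by (simp add: norm_bop_apply_sq gs)
    have "(norm (bop_apply (g w) \<xi>))\<^sup>2
        = \<alpha> * (norm (bop_apply (g 1) \<xi>))\<^sup>2 - (norm (bop_apply (g z) \<xi>))\<^sup>2"
      unfolding gsq
      by (simp add: a_def[symmetric] ga z bop_apply_diff_left bop_apply_scaleR_left cinner_diff_left
          cinner_scaleR_left)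
    also have "\<dots> \<le> \<alpha> * (norm (bop_apply (g 1) \<xi>))\<^sup>2" by simp
    also have "\<dots> \<le> \<alpha> * (norm \<xi>)\<^sup>2"
    proof (intro mult_left_mono power_mono norm_ge_zero)
      have "norm (g 1) \<le> 1"
        using star_hom_on_UNIV_unit(1,2)[OF g] by (rule norm_projection_le)
      then have "norm (g 1) * norm \<xi> \<le> 1 * norm \<xi>" by (intro mult_right_mono norm_ge_zero)
      then show "norm (bop_apply (g 1) \<xi>) \<le> norm \<xi>"
        using norm_bop_apply[of "g 1" \<xi>] by simp
    qed (simp add: \<alpha>_def)
    finally show "(norm (bop_apply (g w) \<xi>))\<^sup>2 \<le> \<alpha> * (norm \<xi>)\<^sup>2" .
  qed
  also have "\<alpha> = (norm (f w))\<^sup>2"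
    by (simp add: \<alpha>_def a_def fs norm_star_mult_self)
  finally show ?thesis by (rule power2_le_imp_le) simp
qed

text \<open>For \<open>\<parallel>y\<parallel> \<le> 1\<close> the element \<open>1 - y* y\<close> has a self-adjoint root, so its image \<open>f 1 - (f y)* f y\<close> is
  positive, and \<open>f 1\<close> is a projection.\<close>

lemma norm_star_hom_on_le:
  fixes f :: "'a :: unital_cstar_algebra \<Rightarrow> 'h :: chilbert_space bop"
  assumes B: "cstar_subalgebra B" "1 \<in> B" and f: "star_hom_on B f" and x: "x \<in> B"
  shows "norm (f x) \<le> norm x"
proof -
  have sub: "complex_vector.subspace B" and mB: "\<And>a b. a \<in> B \<Longrightarrow> b \<in> B \<Longrightarrow> a * b \<in> B"
    and sB: "\<And>a. a \<in> B \<Longrightarrow> star a \<in> B" and C: "closed_unital_subalgebra B"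
    using B by (auto simp: cstar_subalgebra_def closed_unital_subalgebra_def)
  note fs = star_hom_on_simps[OF f]
  have unit_ball: "norm (f y) \<le> 1" if y: "y \<in> B" "norm y \<le> 1" for y
  proof -
    have hB: "star y * y \<in> B" using y mB sB by blast
    have "star (star y * y) = star y * y" "norm (star y * y) \<le> 1"
      using y by (simp_all add: star_mult star_star norm_star_mult_self power_le_one)
    from exists_sqrt_one_minus[OF this] obtain s
      where s: "star s = s" "s * s = 1 - star y * y" "s \<in> B"
      using C hB by blast
    have "f 1 = f (s * s + star y * y)" by (simp add: s)
    also have "\<dots> = star (f s) * f s + star (f y) * f y"
      using y s(1,3) mB[OF s(3) s(3)] hB sB fs(5)[OF s(3)] by (simp add: fs)
    finally have f1: "f 1 = star (f s) * f s + star (f y) * f y" .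
    have nf1: "norm (f 1) \<le> 1"
      using fs(5)[of 1] fs(4)[of 1 1] B by (intro norm_projection_le) simp_all
    have "(norm (f y))\<^sup>2 \<le> 1"
    proof (rule norm_bop_sq_boundI)
      fix \<xi>
      have "(norm (bop_apply (f s) \<xi>))\<^sup>2 + (norm (bop_apply (f y) \<xi>))\<^sup>2
          = Re (cinner (bop_apply (f 1) \<xi>) \<xi>)"
        by (simp add: norm_bop_apply_sq f1 bop_apply_add_left cinner_add_left)
      also have "\<dots> \<le> norm (bop_apply (f 1) \<xi>) * norm \<xi>" by (rule Re_cinner_le)
      also have "\<dots> \<le> (norm (f 1) * norm \<xi>) * norm \<xi>"
        by (intro mult_right_mono norm_bop_apply norm_ge_zero)
      also have "\<dots> \<le> (1 * norm \<xi>) * norm \<xi>"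
        by (intro mult_right_mono nf1 norm_ge_zero)
      finally show "(norm (bop_apply (f y) \<xi>))\<^sup>2 \<le> 1 * (norm \<xi>)\<^sup>2"
        by (simp add: power2_eq_square) (smt (verit) zero_le_square)
    qed simp
    then show ?thesis by (simp add: abs_square_le_1)
  qed
  show ?thesis
  proof (cases "x = 0")
    case True
    then show ?thesis using fs(6) x by simp
  next
    case False
    have "inverse (norm x) *\<^sub>R x \<in> B"
      using complex_vector.subspace_scale[OF sub x] by (simp flip: scaleC_of_real)
    from unit_ball[OF this] have "inverse (norm x) * norm (f x) \<le> 1"
      using False x by (simp add: fs(3))
    then show ?thesis using False by (simp add: field_simps)
  qed
qed

section \<open>Words in the coefficients and the isometry\<close>

text \<open>The triple \<open>(m, a, n)\<close> stands for \<open>U*\<^sup>m \<pi>(a) U\<^sup>n\<close>, and a list of triples for the sum of its entries.\<close>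

type_synonym 'a monomial = "nat \<times> 'a \<times> nat"

fun grade :: "'a monomial \<Rightarrow> int" where
  "grade (m, a, n) = int n - int m"

text \<open>Derived from \<open>U\<^sup>n U*\<^sup>n = \<pi>(\<delta>\<^sup>n(1))\<close> after cancelling the shorter of the powers that meet in the
  middle; justified by \<open>mono_val_times\<close> below.\<close>

fun monomial_times ::
    "('a :: unital_cstar_algebra \<Rightarrow> 'a) \<Rightarrow> 'a monomial \<Rightarrow> 'a monomial \<Rightarrow> 'a monomial" where
  "monomial_times \<delta> (m, a, n) (k, b, l) =
     (if k \<le> n then (m, a * (\<delta> ^^ n) 1 * (\<delta> ^^ (n - k)) b, (n - k) + l)
      else (m + (k - n), (\<delta> ^^ (k - n)) a * (\<delta> ^^ k) 1 * b, l))"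

fun monomial_star :: "'a :: unital_cstar_algebra monomial \<Rightarrow> 'a monomial" where
  "monomial_star (m, a, n) = (n, star a, m)"

fun monomial_scale :: "complex \<Rightarrow> 'a :: unital_cstar_algebra monomial \<Rightarrow> 'a monomial" where
  "monomial_scale c (m, a, n) = (m, c *\<^sub>C a, n)"

text \<open>Products, adjoints and powers of words do not mention any representation. This is what allows one word
  to be evaluated in two representations at the same time.\<close>

definition word_times ::
    "('a :: unital_cstar_algebra \<Rightarrow> 'a) \<Rightarrow> 'a monomial list \<Rightarrow> 'a monomial list \<Rightarrow> 'a monomial list" where
  "word_times \<delta> u v = concat (map (\<lambda>s. map (monomial_times \<delta> s) v) u)"

definition word_diff ::
    "'a :: unital_cstar_algebra monomial list \<Rightarrow> 'a monomial list \<Rightarrow> 'a monomial list" where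
  "word_diff u v = u @ map (monomial_scale (- 1)) v"

fun word_power ::
    "('a :: unital_cstar_algebra \<Rightarrow> 'a) \<Rightarrow> 'a monomial list \<Rightarrow> nat \<Rightarrow> 'a monomial list" where
  "word_power \<delta> w 0 = [(0, 1, 0)]"
| "word_power \<delta> w (Suc p) = word_times \<delta> w (word_power \<delta> w p)"

definition diagonal :: "'a monomial list \<Rightarrow> 'a monomial list" where
  "diagonal w = filter (\<lambda>s. grade s = 0) w"

definition width_le :: "nat \<Rightarrow> 'a monomial list \<Rightarrow> bool" where
  "width_le d w \<longleftrightarrow> (\<forall>s\<in>set w. \<bar>grade s\<bar> \<le> int d)"

lemma grade_monomial_times: "grade (monomial_times \<delta> s t) = grade s + grade t"
  by (cases s; cases t) auto

lemma grade_monomial_star [simp]: "grade (monomial_star s) = - grade s"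
  by (cases s) auto

lemma width_le_word_times:
  "width_le d u \<Longrightarrow> width_le e v \<Longrightarrow> width_le (d + e) (word_times \<delta> u v)"
  unfolding width_le_def word_times_def
  by (auto simp: grade_monomial_times intro!: order_trans[OF abs_triangle_ineq] add_mono simp del: grade.simps)

lemma width_le_word_power: "width_le d w \<Longrightarrow> width_le (p * d) (word_power \<delta> w p)"
proof (induction p)
  case (Suc p)
  from width_le_word_times[OF Suc.prems Suc.IH[OF Suc.prems]] show ?case by simp
qed (simp add: width_le_def)

lemma exists_width_le: "\<exists>d. width_le d w"
proof (induction w)
  case (Cons s w)
  then obtain d where "width_le d w" by blast
  then have "width_le (max d (nat \<bar>grade s\<bar>)) (s # w)"
    by (auto simp: width_le_def)
  then show ?case by blast
qed (simp add: width_le_def)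

lemma sum_over_fibres:
  fixes f :: "'b \<Rightarrow> 'c :: comm_monoid_add"
  assumes "finite K" "\<And>s. s \<in> set w \<Longrightarrow> g s \<in> K"
  shows "(\<Sum>k\<in>K. \<Sum>s\<leftarrow>filter (\<lambda>s. g s = k) w. f s) = (\<Sum>s\<leftarrow>w. f s)"
  using assms(2)
proof (induction w)
  case (Cons s w)
  have "(\<Sum>k\<in>K. \<Sum>s\<leftarrow>filter (\<lambda>s. g s = k) (s # w). f s)
      = (\<Sum>k\<in>K. (if g s = k then f s else 0) + (\<Sum>s\<leftarrow>filter (\<lambda>s. g s = k) w. f s))"
    by (intro sum.cong) auto
  also have "\<dots> = f s + (\<Sum>s\<leftarrow>w. f s)"
    using Cons assms(1) by (simp add: sum.distrib)
  finally show ?case by simp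
qed simp

lemma star_hom_funpow:
  fixes \<delta> :: "'a :: unital_cstar_algebra \<Rightarrow> 'a"
  assumes "star_hom_on UNIV \<delta>"
  shows "star_hom_on UNIV (\<delta> ^^ n)"
  using assms by (induction n) (auto simp: star_hom_on_def)

section \<open>Covariant representations\<close>

locale covariant =
  fixes \<delta> :: "'a :: unital_cstar_algebra \<Rightarrow> 'a"
    and \<pi> :: "'a \<Rightarrow> 'h :: chilbert_space bop" and U :: "'h bop"
  assumes hom_\<delta>: "star_hom_on UNIV \<delta>"
    and cov: "covariant_representation \<delta> \<pi> U"
begin

lemma hom: "star_hom_on UNIV \<pi>" and inj: "inj \<pi>" and nondeg: "nondegenerate \<pi>"
  and U_conj: "U * \<pi> a * star U = \<pi> (\<delta> a)"
  and domain_comm: "star U * U * \<pi> a = \<pi> a * (star U * U)"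
  using cov by (auto simp: covariant_representation_def commutant_def)

lemmas \<pi>_simps = star_hom_on_simps[OF hom, simplified]
lemmas \<delta>n_simps = star_hom_on_simps[OF star_hom_funpow[OF hom_\<delta>], simplified]

lemma \<pi>_one: "\<pi> 1 = 1"
proof -
  define S where "S = {v. bop_apply (\<pi> 1) v = v}"
  have "closed S" unfolding S_def
    by (intro closed_Collect_eq continuous_intros linear_continuous_on bounded_linear_bop_apply)
  moreover have "complex_vector.span {bop_apply (\<pi> a) x | a x. True} \<subseteq> S"
  proof (rule complex_vector.span_minimal)
    show "{bop_apply (\<pi> a) x | a x. True} \<subseteq> S"
      using \<pi>_simps(4)[of 1] by (auto simp: S_def simp flip: bop_apply_times)
    show "complex_vector.subspace S"
      by (auto simp: S_def complex_vector.subspace_def bop_apply_add_right bop_apply_scaleC)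
  qed
  ultimately have "closure (complex_vector.span {bop_apply (\<pi> a) x | a x. True}) \<subseteq> S"
    by (rule closure_minimal[rotated])
  then have "S = UNIV" using nondeg by (auto simp: nondegenerate_def)
  then show ?thesis by (intro bop_eqI) (auto simp: S_def bop_apply_one)
qed

lemma U_star_U: "U * star U = \<pi> (\<delta> 1)"
  using U_conj[of 1] by (simp add: \<pi>_one)

text \<open>Since \<open>U U* = \<pi>(\<delta>(1))\<close> is a projection \<open>q\<close>, the C*-identity applied to \<open>U - q U\<close> gives \<open>U = q U\<close>.\<close>

lemma U_absorb: "U * star U * U = U"
proof -
  define q where "q = \<pi> (\<delta> 1)"
  have q: "star q = q" "q * q = q"
    using star_hom_on_UNIV_unit[OF hom_\<delta>] by (simp_all add: q_def flip: \<pi>_simps)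
  have "(U - q * U) * star (U - q * U) = q - q * q - (q * q - q * q * q)"
    by (simp add: star_diff star_mult q(1) algebra_simps U_star_U[folded q_def]
        flip: mult.assoc) (simp add: mult.assoc U_star_U[folded q_def])
  also have "\<dots> = 0" by (simp add: q)
  finally have "U = q * U"
    using norm_mult_star_self[of "U - q * U"] by simp
  then show ?thesis by (simp add: U_star_U q_def)
qed

lemma U_\<pi>: "U * \<pi> a = \<pi> (\<delta> a) * U"
proof -
  have "\<pi> (\<delta> a) * U = U * (\<pi> a * (star U * U))"
    by (simp add: mult.assoc flip: U_conj)
  also have "\<dots> = U * star U * U * \<pi> a"
    by (simp add: mult.assoc flip: domain_comm)
  finally show ?thesis by (simp add: U_absorb)
qed

lemma Un_\<pi>: "U ^ n * \<pi> a = \<pi> ((\<delta> ^^ n) a) * U ^ n"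
proof (induction n)
  case (Suc n)
  have "U ^ Suc n * \<pi> a = U * \<pi> ((\<delta> ^^ n) a) * U ^ n"
    using Suc by (simp add: mult.assoc)
  then show ?case by (simp add: U_\<pi> mult.assoc)
qed simp

lemma \<pi>_stUn: "\<pi> a * star U ^ n = star U ^ n * \<pi> ((\<delta> ^^ n) a)"
proof -
  have "star (U ^ n * \<pi> (star a)) = star (\<pi> ((\<delta> ^^ n) (star a)) * U ^ n)"
    by (simp only: Un_\<pi>)
  then show ?thesis by (simp add: star_mult star_power star_star \<pi>_simps \<delta>n_simps)
qed

lemma Un_stUn: "U ^ n * star U ^ n = \<pi> ((\<delta> ^^ n) 1)"
proof (induction n)
  case (Suc n)
  have "U ^ Suc n * star U ^ Suc n = U * (U ^ n * star U ^ n) * star U"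
    by (simp add: mult.assoc power_commutes)
  then show ?case by (simp add: Suc U_conj)
qed (simp add: \<pi>_one)

lemma e_Un: "\<pi> ((\<delta> ^^ n) 1) * U ^ n = U ^ n"
  using Un_\<pi>[of n 1] by (simp add: \<pi>_one)

lemma stUn_e: "star U ^ n * \<pi> ((\<delta> ^^ n) 1) = star U ^ n"
  using \<pi>_stUn[of 1 n] by (simp add: \<pi>_one)

lemma norm_Un_le: "norm (U ^ n) \<le> 1" "norm (star U ^ n) \<le> 1"
proof -
  show "norm (U ^ n) \<le> 1"
    by (rule norm_partial_isometry_le) (simp add: star_power Un_stUn e_Un)
  then show "norm (star U ^ n) \<le> 1"
    by (simp flip: star_power)
qed

fun mono_val :: "'a monomial \<Rightarrow> 'h bop" where
  "mono_val (m, a, n) = star U ^ m * \<pi> a * U ^ n"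

definition val :: "'a monomial list \<Rightarrow> 'h bop" where
  "val w = (\<Sum>s\<leftarrow>w. mono_val s)"

text \<open>A coefficient may be compressed to the corner \<open>\<delta>\<^sup>m(1) A \<delta>\<^sup>n(1)\<close> without changing the operator, so words
  can carry arbitrary coefficients although \<open>property_star\<close> only speaks of matrices with entries in these
  corners.\<close>

lemma mono_val_absorb: "mono_val (m, (\<delta> ^^ m) 1 * a * (\<delta> ^^ n) 1, n) = mono_val (m, a, n)"
proof -
  have "mono_val (m, (\<delta> ^^ m) 1 * a * (\<delta> ^^ n) 1, n)
      = (star U ^ m * \<pi> ((\<delta> ^^ m) 1)) * \<pi> a * (\<pi> ((\<delta> ^^ n) 1) * U ^ n)"
    by (simp add: \<pi>_simps mult.assoc)
  then show ?thesis by (simp add: e_Un stUn_e)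
qed

lemma mono_val_absorb_right: "mono_val (m, a * (\<delta> ^^ n) 1, n) = mono_val (m, a, n)"
  by (simp add: \<pi>_simps mult.assoc e_Un)

lemma mono_val_times: "mono_val (monomial_times \<delta> s t) = mono_val s * mono_val t"
proof (cases s; cases t)
  fix m a n k b l assume st: "s = (m, a, n)" "t = (k, b, l)"
  show ?thesis
  proof (cases "k \<le> n")
    case True
    have "U ^ n * star U ^ k = U ^ (n - k) * (U ^ k * star U ^ k)"
      using True by (simp flip: mult.assoc power_add)
    also have "\<dots> = \<pi> ((\<delta> ^^ n) 1) * U ^ (n - k)"
      using True by (simp add: Un_stUn Un_\<pi> flip: funpow_add comp_apply[of "\<delta> ^^ (n - k)"])
    finally have 1: "U ^ n * star U ^ k = \<pi> ((\<delta> ^^ n) 1) * U ^ (n - k)" .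
    have "mono_val s * mono_val t = star U ^ m * \<pi> a * (U ^ n * star U ^ k) * \<pi> b * U ^ l"
      by (simp add: st mult.assoc)
    also have "\<dots> = star U ^ m * \<pi> a * \<pi> ((\<delta> ^^ n) 1) * (U ^ (n - k) * \<pi> b) * U ^ l"
      by (simp only: 1 mult.assoc)
    also have "\<dots> = mono_val (monomial_times \<delta> s t)"
      using True by (simp add: st Un_\<pi> \<pi>_simps mult.assoc flip: power_add)
    finally show ?thesis by simp
  next
    case False
    have "U ^ n * star U ^ k = (U ^ n * star U ^ n) * star U ^ (k - n)"
      using False by (simp add: mult.assoc flip: power_add)
    also have "\<dots> = star U ^ (k - n) * \<pi> ((\<delta> ^^ k) 1)"
      using False by (simp add: Un_stUn \<pi>_stUn flip: funpow_add comp_apply[of "\<delta> ^^ (k - n)"])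
    finally have 1: "U ^ n * star U ^ k = star U ^ (k - n) * \<pi> ((\<delta> ^^ k) 1)" .
    have "mono_val s * mono_val t = star U ^ m * \<pi> a * (U ^ n * star U ^ k) * \<pi> b * U ^ l"
      by (simp add: st mult.assoc)
    also have "\<dots> = star U ^ m * (\<pi> a * star U ^ (k - n)) * \<pi> ((\<delta> ^^ k) 1) * \<pi> b * U ^ l"
      by (simp only: 1 mult.assoc)
    also have "\<dots> = mono_val (monomial_times \<delta> s t)"
      using False by (simp only: st monomial_times.simps mono_val.simps if_False \<pi>_stUn \<pi>_simps(4) power_add mult.assoc)
    finally show ?thesis by simp
  qed
qed

lemma mono_val_star: "mono_val (monomial_star s) = star (mono_val s)"
  by (cases s) (simp add: star_mult star_power star_star \<pi>_simps mult.assoc)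

lemma mono_val_scale: "mono_val (monomial_scale c s) = c *\<^sub>C mono_val s"
  by (cases s) (simp add: \<pi>_simps mult_scaleC_left mult_scaleC_right)

lemma val_Nil [simp]: "val [] = 0"
  and val_Cons: "val (s # w) = mono_val s + val w"
  and val_append: "val (u @ v) = val u + val v"
  by (simp_all add: val_def)

lemma val_star: "val (map monomial_star w) = star (val w)"
  by (induction w) (simp_all add: val_Cons mono_val_star star_add)

lemma val_scale: "val (map (monomial_scale c) w) = c *\<^sub>C val w"
  by (induction w) (simp_all add: val_Cons mono_val_scale scaleC_add_right)

lemma val_diff: "val (word_diff u v) = val u - val v"
  by (simp add: word_diff_def val_append val_scale complex_vector.scale_minus_left scaleC_one)

lemma val_map_times: "val (map (monomial_times \<delta> s) w) = mono_val s * val w"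
  by (induction w) (simp_all add: val_Cons mono_val_times distrib_left)

lemma val_times: "val (word_times \<delta> u v) = val u * val v"
  by (induction u)
    (simp_all add: word_times_def val_Cons val_append val_map_times distrib_right)

lemma val_power: "val (word_power \<delta> w p) = val w ^ p"
  by (induction p) (simp_all add: val_times val_Cons \<pi>_one)

end

section \<open>Grading and the star property\<close>

context covariant
begin

definition component :: "int \<Rightarrow> 'a monomial list \<Rightarrow> 'a monomial list" where
  "component k w = filter (\<lambda>s. grade s = k) w"

lemma val_eq_sum_component:
  assumes "width_le d w"
  shows "val w = (\<Sum>k\<in>{- int d..int d}. val (component k w))"
proof -
  have "(\<Sum>k\<in>{- int d..int d}. \<Sum>s\<leftarrow>filter (\<lambda>s. grade s = k) w. mono_val s) = (\<Sum>s\<leftarrow>w. mono_val s)"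
    by (rule sum_over_fibres) (use assms in \<open>force simp: width_le_def\<close>)+
  then show ?thesis by (simp add: val_def component_def)
qed

lemma component_Nil [simp]: "component k [] = []"
  by (simp add: component_def)

lemma component_map_star: "component k (map monomial_star w) = map monomial_star (component (- k) w)"
  by (induction w) (auto simp: component_def)

text \<open>Grades add up under multiplication, so a product of homogeneous parts lands on the diagonal exactly when
  their grades are opposite.\<close>

lemma val_diagonal_times:
  assumes "width_le d u"
  shows "val (diagonal (word_times \<delta> u v))
    = (\<Sum>k\<in>{- int d..int d}. val (component k u) * val (component (- k) v))"
  using assms
proof (induction u)
  case (Cons s u)
  have w: "width_le d u" and s: "grade s \<in> {- int d..int d}"
    using Cons.prems by (auto simp: width_le_def)
  have "diagonal (map (monomial_times \<delta> s) v) = map (monomial_times \<delta> s) (component (- grade s) v)"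
  proof (induction v)
    case (Cons t v)
    then show ?case
      by (simp add: diagonal_def component_def grade_monomial_times eq_neg_iff_add_eq_0 add.commute)
  qed (simp add: diagonal_def)
  then have "val (diagonal (word_times \<delta> (s # u) v))
      = mono_val s * val (component (- grade s) v) + val (diagonal (word_times \<delta> u v))"
    by (simp add: word_times_def diagonal_def val_append val_map_times)
  also have "mono_val s * val (component (- grade s) v)
      = (\<Sum>k\<in>{- int d..int d}. if grade s = k then mono_val s * val (component (- k) v) else 0)"
    using s by simp
  also have "\<dots> + val (diagonal (word_times \<delta> u v))
      = (\<Sum>k\<in>{- int d..int d}. val (component k (s # u)) * val (component (- k) v))"
    unfolding Cons.IH[OF w] sum.distrib[symmetric]
    by (intro sum.cong) (auto simp: component_def val_Cons distrib_right)
  finally show ?case .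
qed (simp add: word_times_def diagonal_def)

end

lemma norm_sum_sq_le_card:
  fixes x :: "'k \<Rightarrow> 'v :: real_normed_vector"
  assumes "finite K"
  shows "(norm (\<Sum>k\<in>K. x k))\<^sup>2 \<le> real (card K) * (\<Sum>k\<in>K. (norm (x k))\<^sup>2)"
proof -
  have "(norm (\<Sum>k\<in>K. x k))\<^sup>2 \<le> (\<Sum>k\<in>K. norm (x k))\<^sup>2"
    by (intro power_mono norm_sum norm_ge_zero)
  also have "\<dots> = (\<Sum>k\<in>K. 1 * norm (x k))\<^sup>2" by simp
  also have "\<dots> \<le> (\<Sum>k\<in>K. 1\<^sup>2) * (\<Sum>k\<in>K. (norm (x k))\<^sup>2)"
    by (rule Cauchy_Schwarz_ineq_sum)
  finally show ?thesis by simp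
qed

lemma bop_apply_sum: "bop_apply (\<Sum>k\<in>K. S k) \<xi> = (\<Sum>k\<in>K. bop_apply (S k) \<xi>)"
  by (induction K rule: infinite_finite_induct) (simp_all add: bop_apply_add_left)

lemma star_sum: "star (\<Sum>k\<in>K. S k) = (\<Sum>k\<in>K. star (S k :: 'a :: unital_cstar_algebra))"
  by (induction K rule: infinite_finite_induct) (simp_all add: star_add)

lemma cinner_sum_left: "cinner (\<Sum>k\<in>K. x k) y = (\<Sum>k\<in>K. cinner (x k) y)"
  using cinner_scaleC_left[of 0 0 y]
  by (induction K rule: infinite_finite_induct) (simp_all add: cinner_add_left)

text \<open>The operator form of \<open>(\<Sum> t\<^sub>k)\<^sup>2 \<le> n (\<Sum> t\<^sub>k\<^sup>2)\<close>, applied to the vectors \<open>S\<^sub>k* \<xi>\<close>.\<close>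

lemma norm_sum_bop_sq_le:
  fixes S :: "'k \<Rightarrow> 'h :: chilbert_space bop"
  assumes "finite K"
  shows "(norm (\<Sum>k\<in>K. S k))\<^sup>2 \<le> real (card K) * norm (\<Sum>k\<in>K. S k * star (S k))"
proof -
  let ?Q = "\<Sum>k\<in>K. S k * star (S k)"
  have "(norm (star (\<Sum>k\<in>K. S k)))\<^sup>2 \<le> real (card K) * norm ?Q"
  proof (rule norm_bop_sq_boundI)
    fix \<xi>
    have "(norm (bop_apply (star (\<Sum>k\<in>K. S k)) \<xi>))\<^sup>2
        \<le> real (card K) * (\<Sum>k\<in>K. (norm (bop_apply (star (S k)) \<xi>))\<^sup>2)"
      unfolding star_sum bop_apply_sum by (rule norm_sum_sq_le_card[OF assms])
    also have "(\<Sum>k\<in>K. (norm (bop_apply (star (S k)) \<xi>))\<^sup>2) = Re (cinner (bop_apply ?Q \<xi>) \<xi>)"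
      by (simp add: norm_bop_apply_sq star_star bop_apply_sum cinner_sum_left)
    also have "\<dots> \<le> norm ?Q * (norm \<xi>)\<^sup>2"
    proof -
      have "Re (cinner (bop_apply ?Q \<xi>) \<xi>) \<le> norm (bop_apply ?Q \<xi>) * norm \<xi>"
        by (rule Re_cinner_le)
      also have "\<dots> \<le> norm ?Q * norm \<xi> * norm \<xi>"
        by (intro mult_right_mono norm_bop_apply norm_ge_zero)
      finally show ?thesis by (simp add: power2_eq_square)
    qed
    finally show "(norm (bop_apply (star (\<Sum>k\<in>K. S k)) \<xi>))\<^sup>2 \<le> real (card K) * norm ?Q * (norm \<xi>)\<^sup>2"
      by (simp add: mult_left_mono mult.assoc)
  qed simp
  then show ?thesis by simp
qed

context covariant
begin

text \<open>Only homogeneous components of opposite grades survive on the diagonal of a product, so the diagonal part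
  of \<open>x x*\<close> is the sum of \<open>x\<^sub>k x\<^sub>k*\<close> over the homogeneous components of \<open>x\<close>.\<close>

lemma norm_val_sq_le:
  assumes "width_le d w"
  shows "(norm (val w))\<^sup>2
    \<le> (2 * real d + 1) * norm (val (diagonal (word_times \<delta> w (map monomial_star w))))"
proof -
  have "(norm (\<Sum>k\<in>{- int d..int d}. val (component k w)))\<^sup>2
      \<le> real (card {- int d..int d}) * norm (\<Sum>k\<in>{- int d..int d}. val (component k w) * star (val (component k w)))"
    by (rule norm_sum_bop_sq_le) simp
  also have "real (card {- int d..int d}) = 2 * real d + 1" by simp
  finally show ?thesis
    unfolding val_eq_sum_component[OF assms, symmetric] val_diagonal_times[OF assms]
    by (simp add: component_map_star val_star)
qed

text \<open>The matrix with entries in the corners \<open>\<delta>\<^sup>m(1) A \<delta>\<^sup>n(1)\<close> through which \<open>property_star\<close> applies to a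
  word.\<close>

definition matrix_coeff :: "'a monomial list \<Rightarrow> nat \<Rightarrow> nat \<Rightarrow> 'a" where
  "matrix_coeff w m n = (\<delta> ^^ m) 1
     * (\<Sum>s\<leftarrow>filter (\<lambda>s. (fst s, snd (snd s)) = (m, n)) w. fst (snd s)) * (\<delta> ^^ n) 1"

lemma mono_val_matrix_coeff:
  "mono_val (m, matrix_coeff w m n, n) = (\<Sum>s\<leftarrow>filter (\<lambda>s. (fst s, snd (snd s)) = (m, n)) w. mono_val s)"
  unfolding matrix_coeff_def mono_val_absorb
  by (induction w) (auto simp: \<pi>_simps distrib_left distrib_right)

lemma matrix_coeff_support: "{(m, n). matrix_coeff w m n \<noteq> 0} \<subseteq> (\<lambda>s. (fst s, snd (snd s))) ` set w"
proof clarify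
  fix m n assume nz: "matrix_coeff w m n \<noteq> 0"
  show "(m, n) \<in> (\<lambda>s. (fst s, snd (snd s))) ` set w"
  proof (rule ccontr)
    assume "(m, n) \<notin> (\<lambda>s. (fst s, snd (snd s))) ` set w"
    then have "filter (\<lambda>s. (fst s, snd (snd s)) = (m, n)) w = []"
      by (force simp: filter_empty_conv)
    with nz show False by (simp only: matrix_coeff_def) simp
  qed
qed

lemma matrix_coeff_finite_matrix: "matrix_coeff w \<in> finite_matrices \<delta>"
  unfolding finite_matrices_def
  using finite_subset[OF matrix_coeff_support] by (auto simp: matrix_coeff_def)

lemma norm_val_diagonal_le:
  assumes "property_star \<delta> \<pi> U"
  shows "norm (val (diagonal w)) \<le> norm (val w)"
proof -
  let ?g = "\<lambda>s::'a monomial. (fst s, snd (snd s))"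
  have "(\<Sum>(m, n)\<in>{(m, n). matrix_coeff w m n \<noteq> 0}. star U ^ m * \<pi> (matrix_coeff w m n) * U ^ n)
      = (\<Sum>(m, n)\<in>?g ` set w. mono_val (m, matrix_coeff w m n, n))"
    using matrix_coeff_support[of w] by (intro sum.mono_neutral_cong_left) (auto simp: \<pi>_simps)
  also have "\<dots> = (\<Sum>k\<in>?g ` set w. \<Sum>s\<leftarrow>filter (\<lambda>s. ?g s = k) w. mono_val s)"
    by (rule sum.cong) (auto simp: mono_val_matrix_coeff simp del: mono_val.simps)
  also have "\<dots> = val w"
    unfolding val_def by (rule sum_over_fibres) auto
  finally have 1: "(\<Sum>(m, n)\<in>{(m, n). matrix_coeff w m n \<noteq> 0}. star U ^ m * \<pi> (matrix_coeff w m n) * U ^ n) = val w" .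
  have "(\<Sum>m\<in>{m. matrix_coeff w m m \<noteq> 0}. star U ^ m * \<pi> (matrix_coeff w m m) * U ^ m)
      = (\<Sum>m\<in>fst ` set w. mono_val (m, matrix_coeff w m m, m))"
  proof (rule sum.mono_neutral_cong_left)
    show "{m. matrix_coeff w m m \<noteq> 0} \<subseteq> fst ` set w" using matrix_coeff_support[of w] by force
  qed (simp_all add: \<pi>_simps)
  also have "\<dots> = (\<Sum>m\<in>fst ` set w. \<Sum>s\<leftarrow>filter (\<lambda>s. fst s = m) (diagonal w). mono_val s)"
    unfolding mono_val_matrix_coeff diagonal_def filter_filter
    by (intro sum.cong refl arg_cong[of _ _ sum_list] arg_cong[of _ _ "map _"] filter_cong) auto
  also have "\<dots> = val (diagonal w)"
    unfolding val_def by (rule sum_over_fibres) (auto simp: diagonal_def)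
  finally have 2: "(\<Sum>m\<in>{m. matrix_coeff w m m \<noteq> 0}. star U ^ m * \<pi> (matrix_coeff w m m) * U ^ m) = val (diagonal w)" .
  show ?thesis
    using bspec[OF assms[unfolded property_star_def] matrix_coeff_finite_matrix[of w]] unfolding 1 2 .
qed

end

section \<open>Norms of diagonal words\<close>

text \<open>By Pythagoras: \<open>S\<close> is block diagonal with respect to the ranges of \<open>p\<close> and \<open>1 - p\<close>.\<close>

lemma norm_le_of_projection_split:
  fixes S p :: "'h :: chilbert_space bop"
  assumes p: "star p = p" "p * p = p" and comm: "S * p = p * S"
    and le: "norm (S * p) \<le> c" "norm (S * (1 - p)) \<le> c"
  shows "norm S \<le> c"
proof -
  define q where "q = 1 - p"
  have q: "star q = q" "q * q = q" "S * q = q * S"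
    by (simp_all add: q_def star_diff p algebra_simps comm)
  have pyth: "(norm y)\<^sup>2 = (norm (bop_apply p y))\<^sup>2 + (norm (bop_apply q y))\<^sup>2" for y
    by (simp add: norm_bop_apply_sq p q)
      (simp add: q_def bop_apply_diff_left bop_apply_one cinner_diff_left cinner_self)
  have c: "0 \<le> c" using le(1) norm_ge_zero order_trans by blast
  have part: "(norm (bop_apply r (bop_apply S \<xi>)))\<^sup>2 \<le> c\<^sup>2 * (norm (bop_apply r \<xi>))\<^sup>2"
    if r: "r * r = r" "S * r = r * S" "norm (S * r) \<le> c" for r \<xi>
  proof -
    have "r * S = (S * r) * r" by (simp only: mult.assoc r(1)) (simp only: r(2))
    then have "norm (bop_apply r (bop_apply S \<xi>)) = norm (bop_apply (S * r) (bop_apply r \<xi>))"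
      by (simp only: flip: bop_apply_times)
    also have "\<dots> \<le> norm (S * r) * norm (bop_apply r \<xi>)" by (rule norm_bop_apply)
    also have "\<dots> \<le> c * norm (bop_apply r \<xi>)" by (intro mult_right_mono r norm_ge_zero)
    finally have "(norm (bop_apply r (bop_apply S \<xi>)))\<^sup>2 \<le> (c * norm (bop_apply r \<xi>))\<^sup>2"
      by (intro power_mono norm_ge_zero)
    then show ?thesis by (simp add: power_mult_distrib)
  qed
  have "(norm S)\<^sup>2 \<le> c\<^sup>2"
  proof (rule norm_bop_sq_boundI)
    fix \<xi>
    show "(norm (bop_apply S \<xi>))\<^sup>2 \<le> c\<^sup>2 * (norm \<xi>)\<^sup>2"
      using part[OF p(2) comm le(1), of \<xi>] part[OF q(2,3) le(2)[folded q_def], of \<xi>]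
      by (simp add: pyth[of "bop_apply S \<xi>"] pyth[of \<xi>] distrib_left)
  qed simp
  then show ?thesis using c by (rule power2_le_imp_le)
qed

text \<open>A monomial \<open>(m, a, m)\<close> restricted to the range of \<open>U*\<^sup>k U\<^sup>k\<close> with \<open>m \<le> k\<close> acts as
  \<open>(k, \<delta>\<^sup>k\<^sup>-\<^sup>m(a), k)\<close>. This sums up these images over a diagonal word and compresses the result to the
  corner of \<open>\<delta>\<^sup>k(1)\<close>, where conjugation by \<open>U\<^sup>k\<close> is isometric.\<close>

definition level_coeff :: "('a :: unital_cstar_algebra \<Rightarrow> 'a) \<Rightarrow> nat \<Rightarrow> 'a monomial list \<Rightarrow> 'a" where
  "level_coeff \<delta> k w = (\<delta> ^^ k) 1
     * (\<Sum>s\<leftarrow>filter (\<lambda>s. fst s \<le> k) w. (\<delta> ^^ (k - fst s)) (fst (snd s))) * (\<delta> ^^ k) 1"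

context covariant
begin

text \<open>The projection onto the initial space of the partial isometry \<open>U\<^sup>k\<close>.\<close>

definition dom_proj :: "nat \<Rightarrow> 'h bop" where
  "dom_proj k = star U ^ k * U ^ k"

lemma dom_proj_0: "dom_proj 0 = 1"
  by (simp add: dom_proj_def)

lemma dom_proj_eq_mono_val: "dom_proj k = mono_val (k, 1, k)"
  by (simp add: dom_proj_def \<pi>_one)

lemma star_dom_proj: "star (dom_proj k) = dom_proj k"
  by (simp add: dom_proj_def star_mult star_power star_star)

lemma Un_dom_proj:
  assumes "k \<le> n"
  shows "U ^ n * dom_proj k = U ^ n"
proof -
  have "U ^ n = U ^ (n - k) * U ^ k" using assms by (simp flip: power_add)
  then have "U ^ n * dom_proj k = U ^ (n - k) * (U ^ k * star U ^ k * U ^ k)"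
    by (simp add: dom_proj_def mult.assoc)
  also have "\<dots> = U ^ n"
    using assms by (simp add: Un_stUn e_Un flip: power_add)
  finally show ?thesis .
qed

lemma mono_val_dom_proj: "mono_val (m, a, m) * dom_proj k
    = (if k \<le> m then mono_val (m, a, m) else mono_val (k, (\<delta> ^^ (k - m)) a, k))"
proof (cases "k \<le> m")
  case True
  then show ?thesis by (simp add: Un_dom_proj mult.assoc)
next
  case False
  have "mono_val (m, a, m) * dom_proj k = mono_val (monomial_times \<delta> (m, a, m) (k, 1, k))"
    by (simp only: dom_proj_eq_mono_val mono_val_times)
  also have "monomial_times \<delta> (m, a, m) (k, 1, k) = (k, (\<delta> ^^ (k - m)) a * (\<delta> ^^ k) 1, k)"
    using False by simp
  finally show ?thesis using False by (simp only: mono_val_absorb_right if_False)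
qed

lemma dom_proj_mult: "dom_proj j * dom_proj k = dom_proj (max j k)"
proof -
  have le: "dom_proj n * dom_proj m = dom_proj n" if "m \<le> n" for m n
    using Un_dom_proj[OF that] by (simp add: dom_proj_def[of n] mult.assoc)
  then have "dom_proj m * dom_proj n = dom_proj n" if "m \<le> n" for m n
    using that by (metis star_dom_proj star_mult)
  with le show ?thesis by (cases "j \<le> k") (simp_all add: max_def)
qed

lemma dom_proj_val_commute:
  assumes "\<And>s. s \<in> set w \<Longrightarrow> grade s = 0"
  shows "dom_proj k * val w = val w * dom_proj k"
  using assms
proof (induction w)
  case (Cons s w)
  obtain m a where s: "s = (m, a, m)" using Cons.prems[of s] by (cases s) auto
  have "star (mono_val (m, star a, m) * dom_proj k) = mono_val (m, a, m) * dom_proj k"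
    unfolding mono_val_dom_proj
    by (simp add: mono_val_star[symmetric] star_star \<delta>n_simps del: mono_val.simps)
  then have "dom_proj k * mono_val s = mono_val s * dom_proj k"
    by (simp add: s star_mult star_dom_proj mono_val_star[symmetric] star_star del: mono_val.simps)
  then show ?case using Cons by (simp add: val_Cons distrib_left distrib_right)
qed simp

lemma conj_Un_eq_corner:
  "star U ^ k * X * U ^ k
    = star U ^ k * (\<pi> ((\<delta> ^^ k) 1) * X * \<pi> ((\<delta> ^^ k) 1)) * U ^ k"
proof -
  have "star U ^ k * (\<pi> ((\<delta> ^^ k) 1) * X * \<pi> ((\<delta> ^^ k) 1)) * U ^ k
      = (star U ^ k * \<pi> ((\<delta> ^^ k) 1)) * X * (\<pi> ((\<delta> ^^ k) 1) * U ^ k)"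
    by (simp add: mult.assoc)
  then show ?thesis by (simp add: e_Un stUn_e)
qed

text \<open>Conjugation by \<open>U\<^sup>k\<close> can be undone on the corner, and both directions are contractive.\<close>

lemma norm_conj_Un_eq_corner:
  "norm (star U ^ k * X * U ^ k) = norm (\<pi> ((\<delta> ^^ k) 1) * X * \<pi> ((\<delta> ^^ k) 1))"
proof (rule antisym)
  have contract: "norm (a * b * c) \<le> norm b" if "norm a \<le> 1" "norm c \<le> 1" for a b c :: "'h bop"
  proof -
    have "norm (a * b * c) \<le> norm (a * b) * norm c" by (rule norm_mult_ineq)
    also have "\<dots> \<le> (norm a * norm b) * norm c"
      by (intro mult_right_mono norm_mult_ineq norm_ge_zero)
    also have "\<dots> \<le> (1 * norm b) * 1"
      using that by (intro mult_mono) auto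
    finally show ?thesis by simp
  qed
  show "norm (star U ^ k * X * U ^ k) \<le> norm (\<pi> ((\<delta> ^^ k) 1) * X * \<pi> ((\<delta> ^^ k) 1))"
    unfolding conj_Un_eq_corner[of k X] by (intro contract norm_Un_le)
  have "\<pi> ((\<delta> ^^ k) 1) * X * \<pi> ((\<delta> ^^ k) 1) = U ^ k * (star U ^ k * X * U ^ k) * star U ^ k"
    by (simp add: mult.assoc flip: Un_stUn)
  then show "norm (\<pi> ((\<delta> ^^ k) 1) * X * \<pi> ((\<delta> ^^ k) 1)) \<le> norm (star U ^ k * X * U ^ k)"
    by (simp only:) (intro contract norm_Un_le)
qed

text \<open>The part of \<open>\<pi>\<close> that lives on the kernel of \<open>U\<close>. Its kernel is the ideal with which the
  representation is associated.\<close>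

definition defect :: "'a \<Rightarrow> 'h bop" where
  "defect a = \<pi> a * (1 - star U * U)"

lemma star_hom_defect: "star_hom_on UNIV defect"
proof -
  have idem: "(1 - star U * U) * (1 - star U * U) = 1 - star U * U"
    using U_absorb by (simp add: algebra_simps)
  have comm: "(1 - star U * U) * \<pi> a = \<pi> a * (1 - star U * U)" for a
    by (simp add: left_diff_distrib right_diff_distrib domain_comm)
  have "defect (a * b) = defect a * defect b" for a b
  proof -
    have "defect a * defect b = \<pi> a * ((1 - star U * U) * \<pi> b) * (1 - star U * U)"
      by (simp add: defect_def mult.assoc)
    also have "\<dots> = \<pi> a * \<pi> b * ((1 - star U * U) * (1 - star U * U))"
      by (simp only: comm mult.assoc)
    finally show ?thesis by (simp only: idem defect_def \<pi>_simps)
  qed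
  moreover have "defect (star a) = star (defect a)" for a
    using comm[of "star a"] by (simp add: defect_def star_mult star_diff star_star \<pi>_simps)
  ultimately show ?thesis
    by (simp add: star_hom_on_def defect_def \<pi>_simps distrib_right mult_scaleC_left)
qed

lemma defect_eq_0_iff: "defect a = 0 \<longleftrightarrow> star U * U * \<pi> a = \<pi> a"
  by (simp add: defect_def right_diff_distrib domain_comm) (metis domain_comm mult.assoc)

lemma corner_defect: "\<pi> e * defect b * \<pi> e = defect (e * b * e)"
proof -
  have "(1 - star U * U) * \<pi> e = \<pi> e * (1 - star U * U)"
    by (simp add: left_diff_distrib right_diff_distrib domain_comm)
  then show ?thesis by (simp add: defect_def \<pi>_simps mult.assoc)
qed

lemma val_top:
  assumes "\<And>s. s \<in> set w \<Longrightarrow> grade s = 0 \<and> fst s \<le> k"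
  shows "val w * dom_proj k = star U ^ k * \<pi> (level_coeff \<delta> k w) * U ^ k"
proof -
  have "val w * dom_proj k
      = star U ^ k * \<pi> (\<Sum>s\<leftarrow>filter (\<lambda>s. fst s \<le> k) w. (\<delta> ^^ (k - fst s)) (fst (snd s))) * U ^ k"
    using assms
  proof (induction w)
    case (Cons s w)
    obtain m a where s: "s = (m, a, m)" "m \<le> k" using Cons.prems[of s] by (cases s) auto
    have "mono_val s * dom_proj k = mono_val (k, (\<delta> ^^ (k - m)) a, k)"
      unfolding s mono_val_dom_proj using s by auto
    then show ?case using Cons s by (simp add: val_Cons \<pi>_simps distrib_left distrib_right)
  qed (simp add: \<pi>_simps)
  then show ?thesis
    using conj_Un_eq_corner[of k "\<pi> (\<Sum>s\<leftarrow>filter (\<lambda>s. fst s \<le> k) w. (\<delta> ^^ (k - fst s)) (fst (snd s)))"]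
    by (simp add: level_coeff_def \<pi>_simps)
qed

text \<open>Between two consecutive projections only the monomials of level at most \<open>k\<close> act; the others do not
  distinguish the two projections and cancel.\<close>

lemma val_gap:
  assumes "\<And>s. s \<in> set w \<Longrightarrow> grade s = 0"
  shows "val w * (dom_proj k - dom_proj (Suc k)) = star U ^ k * defect (level_coeff \<delta> k w) * U ^ k"
proof -
  note defect_simps = star_hom_on_simps[OF star_hom_defect, simplified]
  have "val w * (dom_proj k - dom_proj (Suc k))
      = star U ^ k * defect (\<Sum>s\<leftarrow>filter (\<lambda>s. fst s \<le> k) w. (\<delta> ^^ (k - fst s)) (fst (snd s))) * U ^ k"
    using assms
  proof (induction w)
    case (Cons s w)
    obtain m a where s: "s = (m, a, m)" using Cons.prems[of s] by (cases s) auto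
    have "mono_val s * (dom_proj k - dom_proj (Suc k))
        = (if m \<le> k then star U ^ k * defect ((\<delta> ^^ (k - m)) a) * U ^ k else 0)"
    proof (cases "m \<le> k")
      case True
      define b where "b = (\<delta> ^^ (k - m)) a"
      have 1: "mono_val s * dom_proj k = mono_val (k, b, k)"
        unfolding s mono_val_dom_proj b_def using True by auto
      have "mono_val s * dom_proj (Suc k) = mono_val (Suc k, \<delta> b, Suc k)"
        unfolding s mono_val_dom_proj b_def using True by (simp add: Suc_diff_le)
      also have "\<dots> = star U ^ k * (star U * \<pi> (\<delta> b)) * U * U ^ k"
        by (simp only: mono_val.simps power_Suc2[of "star U"] power_Suc[of U] mult.assoc)
      also have "star U * \<pi> (\<delta> b) = \<pi> b * star U"
        using \<pi>_stUn[of b 1] by simp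
      finally have "mono_val s * dom_proj (Suc k) = star U ^ k * (\<pi> b * (star U * U)) * U ^ k"
        by (simp add: mult.assoc)
      with 1 show ?thesis using True
        by (simp add: defect_def right_diff_distrib left_diff_distrib mult.assoc flip: b_def)
    next
      case False
      then show ?thesis unfolding s right_diff_distrib mono_val_dom_proj by auto
    qed
    then show ?case using Cons s by (simp add: val_Cons defect_simps distrib_left distrib_right)
  qed (simp add: defect_simps)
  also have "\<dots> = star U ^ k * defect (level_coeff \<delta> k w) * U ^ k"
    by (subst conj_Un_eq_corner) (simp only: level_coeff_def corner_defect)
  finally show ?thesis .
qed

lemma level_coeff_corner: "(\<delta> ^^ k) 1 * level_coeff \<delta> k w * (\<delta> ^^ k) 1 = level_coeff \<delta> k w"
proof -
  have e: "(\<delta> ^^ k) 1 * (\<delta> ^^ k) 1 = (\<delta> ^^ k) 1"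
    by (rule star_hom_on_UNIV_unit(2)[OF star_hom_funpow[OF hom_\<delta>]])
  have "e * (e * b * e) * e = e * b * e" if "e * e = e" for e b :: 'a
  proof -
    have "e * (e * b * e) * e = (e * e) * b * (e * e)" by (simp only: mult.assoc)
    then show ?thesis by (simp only: that)
  qed
  from this[OF e] show ?thesis unfolding level_coeff_def .
qed

lemma norm_val_top:
  assumes "\<And>s. s \<in> set w \<Longrightarrow> grade s = 0 \<and> fst s \<le> k"
  shows "norm (val w * dom_proj k) = norm (\<pi> (level_coeff \<delta> k w))"
  using level_coeff_corner[of k w]
  by (simp only: val_top[OF assms] norm_conj_Un_eq_corner flip: \<pi>_simps(4))

lemma norm_val_gap:
  assumes "\<And>s. s \<in> set w \<Longrightarrow> grade s = 0"
  shows "norm (val w * (dom_proj k - dom_proj (Suc k))) = norm (defect (level_coeff \<delta> k w))"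
  by (simp only: val_gap[OF assms] norm_conj_Un_eq_corner corner_defect level_coeff_corner)

lemma norm_mult_projection_le: "star p = p \<Longrightarrow> p * p = p \<Longrightarrow> norm (S * p) \<le> norm (S :: 'h bop)"
  using norm_mult_ineq[of S p] mult_left_mono[OF norm_projection_le[of p] norm_ge_zero[of S]]
  by simp

lemma norm_level_coeff_le:
  assumes "\<And>s. s \<in> set w \<Longrightarrow> grade s = 0 \<and> fst s \<le> k"
  shows "norm (\<pi> (level_coeff \<delta> k w)) \<le> norm (val w)"
proof -
  have "norm (val w * dom_proj k) \<le> norm (val w)"
    by (rule norm_mult_projection_le) (simp_all add: star_dom_proj dom_proj_mult)
  then show ?thesis by (simp only: norm_val_top[OF assms])
qed

lemma norm_defect_level_coeff_le:
  assumes "\<And>s. s \<in> set w \<Longrightarrow> grade s = 0"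
  shows "norm (defect (level_coeff \<delta> k w)) \<le> norm (val w)"
proof -
  have "norm (val w * (dom_proj k - dom_proj (Suc k))) \<le> norm (val w)"
    by (rule norm_mult_projection_le)
      (simp_all add: star_dom_proj dom_proj_mult star_diff left_diff_distrib right_diff_distrib)
  then show ?thesis by (simp only: norm_val_gap[OF assms])
qed

text \<open>Descending from the projection number \<open>N\<close> to the projection number \<open>0\<close>, which is the identity, each step
  splits off one gap.\<close>

lemma norm_val_le_of_level_coeffs:
  assumes w: "\<And>s. s \<in> set w \<Longrightarrow> grade s = 0 \<and> fst s \<le> N"
    and top: "norm (\<pi> (level_coeff \<delta> N w)) \<le> c"
    and gap: "\<And>k. norm (defect (level_coeff \<delta> k w)) \<le> c"
  shows "norm (val w) \<le> c"
proof -
  have "norm (val w * dom_proj k) \<le> c" if "k \<le> N" for k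
    using that
  proof (induction rule: inc_induct)
    case base
    show ?case using norm_val_top[OF w] top by simp
  next
    case (step k)
    show ?case
    proof (rule norm_le_of_projection_split[where p = "dom_proj (Suc k)"])
      show "val w * dom_proj k * dom_proj (Suc k) = dom_proj (Suc k) * (val w * dom_proj k)"
      proof -
        have "dom_proj (Suc k) * (val w * dom_proj k) = val w * dom_proj (Suc k) * dom_proj k"
          using dom_proj_val_commute[where w = w and k = "Suc k"] w by (simp flip: mult.assoc)
        then show ?thesis by (simp add: mult.assoc dom_proj_mult max_def)
      qed
      show "norm (val w * dom_proj k * dom_proj (Suc k)) \<le> c"
        using step.IH by (simp add: mult.assoc dom_proj_mult)
      have "val w * dom_proj k * (1 - dom_proj (Suc k)) = val w * (dom_proj k - dom_proj (Suc k))"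
        by (simp add: mult.assoc right_diff_distrib dom_proj_mult)
      then show "norm (val w * dom_proj k * (1 - dom_proj (Suc k))) \<le> c"
        using norm_val_gap[where w = w and k = k] w gap[of k] by simp
    qed (simp_all add: star_dom_proj dom_proj_mult)
  qed
  from this[of 0] show ?thesis by (simp add: dom_proj_0)
qed

end

text \<open>The compressions of a diagonal word to the gaps and to the last projection have the norms of the images of its
  level coefficients under \<open>defect\<close> and under \<open>\<pi>\<close>. The kernels of these *-homomorphisms are the same in the two representations,
  so the compressions have the same norms.\<close>

lemma norm_val_diagonal_word_le:
  assumes 1: "covariant \<delta> \<pi>\<^sub>1 U\<^sub>1" and 2: "covariant \<delta> \<pi>\<^sub>2 U\<^sub>2"
    and J: "associated_with_ideal \<pi>\<^sub>1 U\<^sub>1 J" "associated_with_ideal \<pi>\<^sub>2 U\<^sub>2 J"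
    and w: "\<And>s. s \<in> set w \<Longrightarrow> grade s = 0"
  shows "norm (covariant.val \<pi>\<^sub>1 U\<^sub>1 w) \<le> norm (covariant.val \<pi>\<^sub>2 U\<^sub>2 w)"
proof -
  interpret R1: covariant \<delta> \<pi>\<^sub>1 U\<^sub>1 by (rule 1)
  interpret R2: covariant \<delta> \<pi>\<^sub>2 U\<^sub>2 by (rule 2)
  define N where "N = Max (insert 0 (fst ` set w))"
  have N: "grade s = 0 \<and> fst s \<le> N" if "s \<in> set w" for s
    using that w by (auto simp: N_def intro!: Max_ge)
  show ?thesis
  proof (rule R1.norm_val_le_of_level_coeffs[OF N])
    have "\<pi>\<^sub>2 a = 0 \<Longrightarrow> \<pi>\<^sub>1 a = 0" for a
      using injD[OF R2.inj, of a 0] R1.\<pi>_simps(6) R2.\<pi>_simps(6) by simp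
    then have "norm (\<pi>\<^sub>1 (level_coeff \<delta> N w)) \<le> norm (\<pi>\<^sub>2 (level_coeff \<delta> N w))"
      by (rule norm_star_hom_le_of_kernel_subset[OF R2.hom R1.hom])
    also have "\<dots> \<le> norm (R2.val w)" by (rule R2.norm_level_coeff_le[OF N])
    finally show "norm (\<pi>\<^sub>1 (level_coeff \<delta> N w)) \<le> norm (R2.val w)" .
    have "R2.defect a = 0 \<Longrightarrow> R1.defect a = 0" for a
      using J unfolding R1.defect_eq_0_iff R2.defect_eq_0_iff associated_with_ideal_def by blast
    then have dom: "norm (R1.defect (level_coeff \<delta> k w)) \<le> norm (R2.defect (level_coeff \<delta> k w))" for k
      by (rule norm_star_hom_le_of_kernel_subset[OF R2.star_hom_defect R1.star_hom_defect])
    show "norm (R1.defect (level_coeff \<delta> k w)) \<le> norm (R2.val w)" for k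
      by (rule order_trans[OF dom R2.norm_defect_level_coeff_le[OF w]])
  qed
qed

section \<open>Norms of arbitrary words\<close>

lemma norm_power_two_power:
  fixes h :: "'a :: unital_cstar_algebra"
  assumes "star h = h"
  shows "norm (h ^ (2 ^ j)) = norm h ^ (2 ^ j)"
proof (induction j)
  case (Suc j)
  have "norm (h ^ (2 ^ Suc j)) = norm (star (h ^ (2 ^ j)) * h ^ (2 ^ j))"
    by (simp add: star_power assms mult_2 flip: power_add)
  also have "\<dots> = (norm h ^ (2 ^ j))\<^sup>2"
    by (simp only: norm_star_mult_self Suc)
  finally show ?case by (simp add: mult.commute flip: power_mult)
qed simp

text \<open>A ratio \<open>A / B > 1\<close> would have powers growing quadratically in the exponent by Bernoulli's inequality,
  against a linear bound. Only the exponents \<open>2\<^sup>j\<close> are used, because for these the C*-identity gives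
  \<open>\<parallel>h\<^sup>p\<parallel> = \<parallel>h\<parallel>\<^sup>p\<close>.\<close>

lemma le_of_powers_le_linear_factor:
  fixes A B c :: real
  assumes nonneg: "0 \<le> A" "0 \<le> B"
    and le: "\<And>j. (A ^ (2 ^ j))\<^sup>2 \<le> (c * 2 ^ j + 1) * (B ^ (2 ^ j))\<^sup>2"
  shows "A \<le> B"
proof (rule ccontr)
  assume "\<not> A \<le> B"
  then have AB: "B < A" by simp
  show False
  proof (cases "B = 0")
    case True
    then show False using le[of 0] AB by simp
  next
    case False
    then have B: "B > 0" using nonneg by simp
    define x where "x = A / B - 1"
    have x: "x > 0" using AB B by (simp add: x_def)
    obtain j where j: "c / x\<^sup>2 < 2 ^ j"
      using real_arch_pow[of 2 "c / x\<^sup>2"] by auto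
    have "((A / B) ^ (2 ^ j))\<^sup>2 \<le> c * 2 ^ j + 1"
      using le[of j] B by (simp add: power_divide divide_le_eq)
    moreover have "1 + 2 ^ j * x \<le> (A / B) ^ (2 ^ j)"
      using Bernoulli_inequality[of x "2 ^ j"] x by (simp add: x_def)
    then have "(1 + 2 ^ j * x)\<^sup>2 \<le> ((A / B) ^ (2 ^ j))\<^sup>2"
      using x by (intro power_mono) auto
    ultimately have "(1 + 2 ^ j * x)\<^sup>2 \<le> c * 2 ^ j + 1" by linarith
    then have "2 ^ j * (2 * x + 2 ^ j * x\<^sup>2) \<le> 2 ^ j * c"
      by (simp add: power2_eq_square algebra_simps)
    then have "2 * x + 2 ^ j * x\<^sup>2 \<le> c" by simp
    moreover have "c < 2 ^ j * x\<^sup>2" using j x by (simp add: divide_less_eq)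
    ultimately show False using x by simp
  qed
qed

text \<open>The diagonal part of \<open>v v*\<close> carries the estimate across: its norm bounds the value of \<open>v\<close> in the first
  representation up to the factor \<open>2 d + 1\<close>, it is not larger in the first representation than in the
  second, and there \<open>property_star\<close> applies. Powers of \<open>w* w\<close> then remove the factor.\<close>

lemma norm_val_le_other_representation:
  assumes 1: "covariant \<delta> \<pi>\<^sub>1 U\<^sub>1" and 2: "covariant \<delta> \<pi>\<^sub>2 U\<^sub>2"
    and J: "associated_with_ideal \<pi>\<^sub>1 U\<^sub>1 J" "associated_with_ideal \<pi>\<^sub>2 U\<^sub>2 J"
    and star: "property_star \<delta> \<pi>\<^sub>2 U\<^sub>2"
  shows "norm (covariant.val \<pi>\<^sub>1 U\<^sub>1 w) \<le> norm (covariant.val \<pi>\<^sub>2 U\<^sub>2 w)"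
proof -
  interpret R1: covariant \<delta> \<pi>\<^sub>1 U\<^sub>1 by (rule 1)
  interpret R2: covariant \<delta> \<pi>\<^sub>2 U\<^sub>2 by (rule 2)
  have width: "(norm (R1.val v))\<^sup>2 \<le> (2 * real d + 1) * (norm (R2.val v))\<^sup>2"
    if "width_le d v" for d v
  proof -
    let ?vv = "word_times \<delta> v (map monomial_star v)"
    have "norm (R1.val (diagonal ?vv)) \<le> norm (R2.val (diagonal ?vv))"
      by (rule norm_val_diagonal_word_le[OF 1 2 J]) (simp add: diagonal_def)
    also have "\<dots> \<le> norm (R2.val ?vv)" by (rule R2.norm_val_diagonal_le[OF star])
    also have "\<dots> = (norm (R2.val v))\<^sup>2"
      by (simp add: R2.val_times R2.val_star norm_mult_star_self)
    finally have "(2 * real d + 1) * norm (R1.val (diagonal ?vv)) \<le> (2 * real d + 1) * (norm (R2.val v))\<^sup>2"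
      by (intro mult_left_mono) auto
    then show ?thesis using R1.norm_val_sq_le[OF that] by linarith
  qed
  define h where "h = word_times \<delta> (map monomial_star w) w"
  have h1: "R1.val h = star (R1.val w) * R1.val w"
    by (simp add: h_def R1.val_times R1.val_star)
  have h2: "R2.val h = star (R2.val w) * R2.val w"
    by (simp add: h_def R2.val_times R2.val_star)
  obtain d where d: "width_le d h" using exists_width_le by blast
  have "norm (R1.val h) \<le> norm (R2.val h)"
  proof (rule le_of_powers_le_linear_factor[where c = "2 * real d"])
    fix j
    have sa: "star (R1.val h) = R1.val h" by (simp add: h1 star_mult star_star)
    have "(norm (R1.val h) ^ (2 ^ j))\<^sup>2 = (norm (R1.val (word_power \<delta> h (2 ^ j))))\<^sup>2"
      by (simp add: R1.val_power norm_power_two_power[OF sa])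
    also have "\<dots> \<le> (2 * real (2 ^ j * d) + 1) * (norm (R2.val (word_power \<delta> h (2 ^ j))))\<^sup>2"
      by (rule width[OF width_le_word_power[OF d]])
    also have "\<dots> \<le> (2 * real (2 ^ j * d) + 1) * (norm (R2.val h) ^ (2 ^ j))\<^sup>2"
      unfolding R2.val_power by (intro mult_left_mono power_mono norm_power_le) auto
    finally show "(norm (R1.val h) ^ (2 ^ j))\<^sup>2 \<le> (2 * real d * 2 ^ j + 1) * (norm (R2.val h) ^ (2 ^ j))\<^sup>2"
      by (simp add: mult_ac)
  qed simp_all
  then have "(norm (R1.val w))\<^sup>2 \<le> (norm (R2.val w))\<^sup>2"
    by (simp add: h1 h2 norm_star_mult_self)
  then show ?thesis by (rule power2_le_imp_le) simp
qed

section \<open>The generated C*-algebras\<close>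

lemma bounded_linear_scaleC_right: "bounded_linear (\<lambda>x :: 'a :: complex_normed_vector. c *\<^sub>C x)"
proof (rule bounded_linear_intro[where K = "cmod c"])
  show "c *\<^sub>C (r *\<^sub>R x) = r *\<^sub>R (c *\<^sub>C x)" for r and x :: 'a
    by (simp add: scaleC_of_real[symmetric] scaleC_scaleC mult.commute)
qed (simp_all add: scaleC_add_right norm_scaleC mult.commute)

lemma tendsto_scaleC:
  fixes f :: "'b \<Rightarrow> 'a :: complex_normed_vector"
  assumes "(f \<longlongrightarrow> a) F"
  shows "((\<lambda>x. c *\<^sub>C f x) \<longlongrightarrow> c *\<^sub>C a) F"
  by (rule bounded_linear.tendsto[OF bounded_linear_scaleC_right assms])

lemma closure_binary_op:
  fixes f :: "'a :: metric_space \<Rightarrow> 'a \<Rightarrow> 'a"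
  assumes cont: "\<And>X Y x y. X \<longlonglongrightarrow> x \<Longrightarrow> Y \<longlonglongrightarrow> y \<Longrightarrow> (\<lambda>n. f (X n) (Y n)) \<longlonglongrightarrow> f x y"
    and S: "\<And>x y. x \<in> S \<Longrightarrow> y \<in> S \<Longrightarrow> f x y \<in> S"
    and xy: "x \<in> closure S" "y \<in> closure S"
  shows "f x y \<in> closure S"
proof -
  obtain X Y where "\<And>n. X n \<in> S" "X \<longlonglongrightarrow> x" "\<And>n. Y n \<in> S" "Y \<longlonglongrightarrow> y"
    using xy unfolding closure_sequential by metis
  then show ?thesis
    unfolding closure_sequential using S cont by (intro exI[of _ "\<lambda>n. f (X n) (Y n)"]) auto
qed

lemma closure_unary_op:
  fixes f :: "'a :: metric_space \<Rightarrow> 'a"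
  assumes cont: "\<And>X x. X \<longlonglongrightarrow> x \<Longrightarrow> (\<lambda>n. f (X n)) \<longlonglongrightarrow> f x"
    and S: "\<And>x. x \<in> S \<Longrightarrow> f x \<in> S" and x: "x \<in> closure S"
  shows "f x \<in> closure S"
  by (rule closure_binary_op[where f = "\<lambda>x _. f x", OF _ _ x x]) (use cont S in auto)

context covariant
begin

lemma cstar_subalgebra_closure_range_val: "cstar_subalgebra (closure (range val))"
proof -
  have add: "x + y \<in> closure (range val)" if "x \<in> closure (range val)" "y \<in> closure (range val)" for x y
    by (rule closure_binary_op[OF _ _ that])
      (auto intro: tendsto_add simp flip: val_append)
  have mult: "x * y \<in> closure (range val)" if "x \<in> closure (range val)" "y \<in> closure (range val)" for x y
    by (rule closure_binary_op[OF _ _ that])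
      (auto intro: tendsto_mult simp flip: val_times)
  have star: "star x \<in> closure (range val)" if x: "x \<in> closure (range val)" for x
  proof (rule closure_unary_op[OF _ _ x, where f = star])
    fix y assume "y \<in> range val"
    then obtain w where "y = val w" by (rule rangeE)
    then show "star y \<in> range val" using rangeI[of val "map monomial_star w"] by (simp only: val_star)
  qed (rule bounded_linear.tendsto[OF bounded_linear_star])
  have scale: "c *\<^sub>C x \<in> closure (range val)" if x: "x \<in> closure (range val)" for c x
  proof (rule closure_unary_op[OF _ _ x, where f = "scaleC c"])
    fix y assume "y \<in> range val"
    then obtain w where "y = val w" by (rule rangeE)
    then show "c *\<^sub>C y \<in> range val" using rangeI[of val "map (monomial_scale c) w"] by (simp only: val_scale)
  qed (rule tendsto_scaleC)
  have "val [] \<in> closure (range val)" by (rule subsetD[OF closure_subset rangeI])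
  then have "0 \<in> closure (range val)" by simp
  then show ?thesis
    unfolding cstar_subalgebra_def complex_vector.subspace_def
    by (intro conjI allI ballI impI add mult star scale closed_closure)
qed

lemma \<pi>_eq_val: "\<pi> a = val [(0, a, 0)]" and U_eq_val: "U = val [(0, 1, 1)]"
  by (simp_all add: val_Cons \<pi>_one)

lemma one_in_range_val: "1 \<in> closure (range val)"
  using closure_subset \<pi>_eq_val[of 1] \<pi>_one by (metis rangeI subsetD)

lemma cstar_generated_eq: "cstar_generated \<pi> U = closure (range val)"
proof
  show "cstar_generated \<pi> U \<subseteq> closure (range val)"
    unfolding cstar_generated_def
  proof (rule hull_minimal)
    have "insert U (range \<pi>) \<subseteq> range val"
      using \<pi>_eq_val U_eq_val by (metis insert_subset image_subsetI rangeI)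
    then show "insert U (range \<pi>) \<subseteq> closure (range val)" using closure_subset by blast
  qed (rule cstar_subalgebra_closure_range_val)
  show "closure (range val) \<subseteq> cstar_generated \<pi> U"
    unfolding cstar_generated_def hull_def
  proof (rule Inter_greatest)
    fix C assume "C \<in> {C. cstar_subalgebra C \<and> insert U (range \<pi>) \<subseteq> C}"
    then have C: "closed C" "complex_vector.subspace C" "\<And>a b. a \<in> C \<Longrightarrow> b \<in> C \<Longrightarrow> a * b \<in> C"
      "\<And>a. a \<in> C \<Longrightarrow> star a \<in> C" and gen: "U \<in> C" "\<And>a. \<pi> a \<in> C"
      by (auto simp: cstar_subalgebra_def)
    have pow: "u ^ n \<in> C" if "u \<in> C" for u n
      using gen(2)[of 1] by (induction n) (simp_all add: \<pi>_one C that)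
    have "mono_val s \<in> C" for s
      by (cases s) (simp add: C gen pow)
    then have "val w \<in> C" for w
      by (induction w)
        (simp_all add: val_Cons complex_vector.subspace_0 complex_vector.subspace_add C)
    then show "closure (range val) \<subseteq> C"
      using C(1) by (intro closure_minimal) auto
  qed
qed

end

text \<open>The graph of the isomorphism, described symmetrically in the two representations: existence of values and
  surjectivity become the same statement with the arguments exchanged.\<close>

definition limit_pairs ::
    "('w \<Rightarrow> 'b :: real_normed_vector) \<Rightarrow> ('w \<Rightarrow> 'c :: real_normed_vector) \<Rightarrow> ('b \<times> 'c) set" where
  "limit_pairs v\<^sub>1 v\<^sub>2 = {(x, y). \<exists>w. (\<lambda>n::nat. v\<^sub>1 (w n)) \<longlonglongrightarrow> x \<and> (\<lambda>n. v\<^sub>2 (w n)) \<longlonglongrightarrow> y}"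

lemma limit_pairsE:
  assumes "(x, y) \<in> limit_pairs v\<^sub>1 v\<^sub>2"
  obtains w where "(\<lambda>n. v\<^sub>1 (w n)) \<longlonglongrightarrow> x" "(\<lambda>n. v\<^sub>2 (w n)) \<longlonglongrightarrow> y"
  using assms unfolding limit_pairs_def by blast

lemma limit_pairs_swap: "(x, y) \<in> limit_pairs v\<^sub>1 v\<^sub>2 \<longleftrightarrow> (y, x) \<in> limit_pairs v\<^sub>2 v\<^sub>1"
  by (auto simp: limit_pairs_def)

lemma limit_pairs_total:
  fixes v\<^sub>1 :: "'w \<Rightarrow> 'b :: real_normed_vector" and v\<^sub>2 :: "'w \<Rightarrow> 'c :: banach"
  assumes iso: "\<And>u w. norm (v\<^sub>1 u - v\<^sub>1 w) = norm (v\<^sub>2 u - v\<^sub>2 w)"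
    and x: "x \<in> closure (range v\<^sub>1)"
  shows "\<exists>y. (x, y) \<in> limit_pairs v\<^sub>1 v\<^sub>2"
proof -
  obtain X where X: "\<And>n. X n \<in> range v\<^sub>1" "X \<longlonglongrightarrow> x"
    using x unfolding closure_sequential by blast
  then obtain w where w: "\<And>n. X n = v\<^sub>1 (w n)" unfolding image_def by (auto, metis)
  have "Cauchy X" using X(2) by (rule LIMSEQ_imp_Cauchy)
  then have "Cauchy (\<lambda>n. v\<^sub>2 (w n))"
    unfolding Cauchy_def dist_norm w iso .
  then obtain y where "(\<lambda>n. v\<^sub>2 (w n)) \<longlonglongrightarrow> y"
    using Cauchy_convergent_iff convergent_def by blast
  moreover have "(\<lambda>n. v\<^sub>1 (w n)) \<longlonglongrightarrow> x" using X(2) by (simp flip: w)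
  ultimately show ?thesis by (auto simp: limit_pairs_def)
qed

lemma limit_pairs_isometric:
  assumes iso: "\<And>u w. norm (v\<^sub>1 u - v\<^sub>1 w) = norm (v\<^sub>2 u - v\<^sub>2 w)"
    and xy: "(x, y) \<in> limit_pairs v\<^sub>1 v\<^sub>2" "(x', y') \<in> limit_pairs v\<^sub>1 v\<^sub>2"
  shows "norm (x - x') = norm (y - y')"
proof -
  obtain w where w: "(\<lambda>n. v\<^sub>1 (w n)) \<longlonglongrightarrow> x" "(\<lambda>n. v\<^sub>2 (w n)) \<longlonglongrightarrow> y"
    using xy(1) by (rule limit_pairsE)
  obtain w' where w': "(\<lambda>n. v\<^sub>1 (w' n)) \<longlonglongrightarrow> x'" "(\<lambda>n. v\<^sub>2 (w' n)) \<longlonglongrightarrow> y'"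
    using xy(2) by (rule limit_pairsE)
  have "(\<lambda>n. norm (v\<^sub>1 (w n) - v\<^sub>1 (w' n))) \<longlonglongrightarrow> norm (x - x')"
    by (intro tendsto_intros w w')
  moreover have "(\<lambda>n. norm (v\<^sub>1 (w n) - v\<^sub>1 (w' n))) \<longlonglongrightarrow> norm (y - y')"
    unfolding iso by (intro tendsto_intros w w')
  ultimately show ?thesis by (rule LIMSEQ_unique)
qed

lemma limit_pairs_in_closure:
  assumes "(x, y) \<in> limit_pairs v\<^sub>1 v\<^sub>2"
  shows "x \<in> closure (range v\<^sub>1)" "y \<in> closure (range v\<^sub>2)"
proof -
  obtain w where w: "(\<lambda>n. v\<^sub>1 (w n)) \<longlonglongrightarrow> x" "(\<lambda>n. v\<^sub>2 (w n)) \<longlonglongrightarrow> y"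
    using assms by (rule limit_pairsE)
  show "x \<in> closure (range v\<^sub>1)"
    unfolding closure_sequential by (rule exI[of _ "\<lambda>n. v\<^sub>1 (w n)"]) (simp add: w)
  show "y \<in> closure (range v\<^sub>2)"
    unfolding closure_sequential by (rule exI[of _ "\<lambda>n. v\<^sub>2 (w n)"]) (simp add: w)
qed

text \<open>Equality of norms makes the correspondence between the two values of a word isometric, hence single-valued in both
  directions and compatible with limits. The algebraic operations pass from words to limits.\<close>

lemma exists_star_isomorphism_of_val:
  assumes 1: "covariant \<delta> \<pi>\<^sub>1 U\<^sub>1" and 2: "covariant \<delta> \<pi>\<^sub>2 U\<^sub>2"
    and norm_eq: "\<And>w. norm (covariant.val \<pi>\<^sub>1 U\<^sub>1 w) = norm (covariant.val \<pi>\<^sub>2 U\<^sub>2 w)"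
  shows "\<exists>\<Phi>. \<Phi> \<in> extensional (cstar_generated \<pi>\<^sub>1 U\<^sub>1)
      \<and> star_isomorphism (cstar_generated \<pi>\<^sub>1 U\<^sub>1) (cstar_generated \<pi>\<^sub>2 U\<^sub>2) \<Phi>
      \<and> (\<forall>a. \<Phi> (\<pi>\<^sub>1 a) = \<pi>\<^sub>2 a) \<and> \<Phi> U\<^sub>1 = U\<^sub>2"
proof -
  interpret R1: covariant \<delta> \<pi>\<^sub>1 U\<^sub>1 by (rule 1)
  interpret R2: covariant \<delta> \<pi>\<^sub>2 U\<^sub>2 by (rule 2)
  let ?G = "limit_pairs R1.val R2.val"
  let ?B1 = "cstar_generated \<pi>\<^sub>1 U\<^sub>1" and ?B2 = "cstar_generated \<pi>\<^sub>2 U\<^sub>2"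
  have iso: "norm (R1.val u - R1.val w) = norm (R2.val u - R2.val w)" for u w
    using norm_eq[of "word_diff u w"] by (simp add: R1.val_diff R2.val_diff)
  note isometric = limit_pairs_isometric[OF iso]
  have total: "\<exists>y. (x, y) \<in> ?G" if "x \<in> ?B1" for x
    using limit_pairs_total[OF iso] that by (simp add: R1.cstar_generated_eq)
  have onto: "\<exists>x. (x, y) \<in> ?G" if "y \<in> ?B2" for y
    using limit_pairs_total[OF iso[symmetric]] that
    by (simp add: R2.cstar_generated_eq limit_pairs_swap[of _ y])
  have dom: "x \<in> ?B1" and ran: "y \<in> ?B2" if "(x, y) \<in> ?G" for x y
    using limit_pairs_in_closure[OF that] by (simp_all add: R1.cstar_generated_eq R2.cstar_generated_eq)
  define \<Phi> where "\<Phi> = restrict (\<lambda>x. THE y. (x, y) \<in> ?G) ?B1"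
  have \<Phi>_eqI: "\<Phi> x = y" if "(x, y) \<in> ?G" for x y
  proof -
    have "(THE y. (x, y) \<in> ?G) = y"
    proof (rule the_equality)
      show "(x, y) \<in> ?G" by (rule that)
      show "y' = y" if "(x, y') \<in> ?G" for y'
        using isometric[OF that \<open>(x, y) \<in> ?G\<close>] by simp
    qed
    then show ?thesis using dom[OF that] by (simp add: \<Phi>_def)
  qed
  have graph: "(x, \<Phi> x) \<in> ?G" if x: "x \<in> ?B1" for x
  proof -
    obtain y where "(x, y) \<in> ?G" using total[OF x] by blast
    then show ?thesis by (simp add: \<Phi>_eqI)
  qed
  have base: "(R1.val w, R2.val w) \<in> ?G" for w
    unfolding limit_pairs_def by (simp, intro exI[of _ "\<lambda>_. w"]) simp
  have G_add: "(x + x', y + y') \<in> ?G" if xy: "(x, y) \<in> ?G" "(x', y') \<in> ?G" for x y x' y'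
  proof -
    obtain w where w: "(\<lambda>n. R1.val (w n)) \<longlonglongrightarrow> x" "(\<lambda>n. R2.val (w n)) \<longlonglongrightarrow> y"
      using xy(1) by (rule limit_pairsE)
    obtain w' where "(\<lambda>n. R1.val (w' n)) \<longlonglongrightarrow> x'" "(\<lambda>n. R2.val (w' n)) \<longlonglongrightarrow> y'"
      using xy(2) by (rule limit_pairsE)
    with w have "(\<lambda>n. R1.val (w n @ w' n)) \<longlonglongrightarrow> x + x' \<and> (\<lambda>n. R2.val (w n @ w' n)) \<longlonglongrightarrow> y + y'"
      by (simp add: R1.val_append R2.val_append tendsto_add)
    then show ?thesis unfolding limit_pairs_def mem_Collect_eq prod.case
      by (rule exI[of _ "\<lambda>n. w n @ w' n"])
  qed
  have G_mult: "(x * x', y * y') \<in> ?G" if xy: "(x, y) \<in> ?G" "(x', y') \<in> ?G" for x y x' y'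
  proof -
    obtain w where w: "(\<lambda>n. R1.val (w n)) \<longlonglongrightarrow> x" "(\<lambda>n. R2.val (w n)) \<longlonglongrightarrow> y"
      using xy(1) by (rule limit_pairsE)
    obtain w' where "(\<lambda>n. R1.val (w' n)) \<longlonglongrightarrow> x'" "(\<lambda>n. R2.val (w' n)) \<longlonglongrightarrow> y'"
      using xy(2) by (rule limit_pairsE)
    with w have "(\<lambda>n. R1.val (word_times \<delta> (w n) (w' n))) \<longlonglongrightarrow> x * x'
        \<and> (\<lambda>n. R2.val (word_times \<delta> (w n) (w' n))) \<longlonglongrightarrow> y * y'"
      by (simp add: R1.val_times R2.val_times tendsto_mult)
    then show ?thesis unfolding limit_pairs_def mem_Collect_eq prod.case
      by (rule exI[of _ "\<lambda>n. word_times \<delta> (w n) (w' n)"])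
  qed
  have G_star: "(star x, star y) \<in> ?G" if xy: "(x, y) \<in> ?G" for x y
  proof -
    obtain w where "(\<lambda>n. R1.val (w n)) \<longlonglongrightarrow> x" "(\<lambda>n. R2.val (w n)) \<longlonglongrightarrow> y"
      using xy by (rule limit_pairsE)
    then have "(\<lambda>n. R1.val (map monomial_star (w n))) \<longlonglongrightarrow> star x
        \<and> (\<lambda>n. R2.val (map monomial_star (w n))) \<longlonglongrightarrow> star y"
      by (simp add: R1.val_star R2.val_star bounded_linear.tendsto[OF bounded_linear_star])
    then show ?thesis unfolding limit_pairs_def mem_Collect_eq prod.case
      by (rule exI[of _ "\<lambda>n. map monomial_star (w n)"])
  qed
  have G_scale: "(c *\<^sub>C x, c *\<^sub>C y) \<in> ?G" if xy: "(x, y) \<in> ?G" for c x y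
  proof -
    obtain w where "(\<lambda>n. R1.val (w n)) \<longlonglongrightarrow> x" "(\<lambda>n. R2.val (w n)) \<longlonglongrightarrow> y"
      using xy by (rule limit_pairsE)
    then have "(\<lambda>n. R1.val (map (monomial_scale c) (w n))) \<longlonglongrightarrow> c *\<^sub>C x
        \<and> (\<lambda>n. R2.val (map (monomial_scale c) (w n))) \<longlonglongrightarrow> c *\<^sub>C y"
      by (simp add: R1.val_scale R2.val_scale tendsto_scaleC)
    then show ?thesis unfolding limit_pairs_def mem_Collect_eq prod.case
      by (rule exI[of _ "\<lambda>n. map (monomial_scale c) (w n)"])
  qed
  have "star_hom_on ?B1 \<Phi>"
    unfolding star_hom_on_def
    by (intro conjI ballI allI \<Phi>_eqI G_add G_mult G_star G_scale graph)
  moreover have "bij_betw \<Phi> ?B1 ?B2"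
  proof (rule bij_betw_imageI)
    show "inj_on \<Phi> ?B1"
    proof (rule inj_onI)
      fix x x' assume x: "x \<in> ?B1" "x' \<in> ?B1" "\<Phi> x = \<Phi> x'"
      show "x = x'"
        using isometric[OF graph[OF x(1)] graph[OF x(2)]] x(3) by simp
    qed
    show "\<Phi> ` ?B1 = ?B2"
    proof
      show "\<Phi> ` ?B1 \<subseteq> ?B2" using graph ran by blast
      show "?B2 \<subseteq> \<Phi> ` ?B1"
      proof
        fix y assume "y \<in> ?B2"
        then obtain x where "(x, y) \<in> ?G" using onto by blast
        then show "y \<in> \<Phi> ` ?B1" by (intro image_eqI[of _ _ x]) (simp_all add: \<Phi>_eqI dom)
      qed
    qed
  qed
  moreover have "\<Phi> (\<pi>\<^sub>1 a) = \<pi>\<^sub>2 a" for a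
    using \<Phi>_eqI[OF base[of "[(0, a, 0)]"]] by (simp only: R1.\<pi>_eq_val R2.\<pi>_eq_val)
  moreover have "\<Phi> U\<^sub>1 = U\<^sub>2"
    using \<Phi>_eqI[OF base[of "[(0, 1, 1)]"]] by (simp only: flip: R1.U_eq_val R2.U_eq_val)
  moreover have "\<Phi> \<in> extensional ?B1" by (simp add: \<Phi>_def)
  ultimately show ?thesis by (auto simp: star_isomorphism_def)
qed

text \<open>The set on which \<open>f\<close> and \<open>g\<close> agree is a C*-subalgebra: it is closed because *-homomorphisms are contractive.\<close>

lemma star_hom_on_cstar_generated_eqI:
  assumes cov: "covariant \<delta> \<pi> U"
    and homs: "star_hom_on (cstar_generated \<pi> U) f" "star_hom_on (cstar_generated \<pi> U) g"
    and eq: "\<And>a. f (\<pi> a) = g (\<pi> a)" "f U = (g U :: 'k :: chilbert_space bop)"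
    and x: "x \<in> cstar_generated \<pi> U"
  shows "f x = g x"
proof -
  interpret covariant \<delta> \<pi> U by (rule cov)
  let ?B = "cstar_generated \<pi> U"
  have B: "cstar_subalgebra ?B" "1 \<in> ?B"
    using cstar_subalgebra_closure_range_val one_in_range_val by (simp_all add: cstar_generated_eq)
  then have clB: "closed ?B" and sub: "complex_vector.subspace ?B"
    and mB: "\<And>a b. a \<in> ?B \<Longrightarrow> b \<in> ?B \<Longrightarrow> a * b \<in> ?B"
    and sB: "\<And>a. a \<in> ?B \<Longrightarrow> star a \<in> ?B"
    by (auto simp: cstar_subalgebra_def)
  have cont: "(\<lambda>n. h (X n)) \<longlonglongrightarrow> h a"
    if h: "star_hom_on ?B h" and X: "\<And>n. X n \<in> ?B" "X \<longlonglongrightarrow> a" "a \<in> ?B"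
    for h :: "'b bop \<Rightarrow> 'k bop" and X a
  proof -
    have le: "norm (h (X n) - h a) \<le> norm (X n - a)" for n
    proof -
      have na: "- a \<in> ?B" using sub X(3) by (rule complex_vector.subspace_neg)
      then have "X n - a \<in> ?B"
        using complex_vector.subspace_add[OF sub X(1)[of n] na] by simp
      from norm_star_hom_on_le[OF B h this] show ?thesis
        using star_hom_on_add[OF h X(1)[of n] na] star_hom_on_minus[OF h X(3)] by simp
    qed
    have "(\<lambda>n. norm (X n - a)) \<longlonglongrightarrow> 0"
      using X(2) by (simp add: LIM_zero_iff tendsto_norm_zero)
    then have "(\<lambda>n. h (X n) - h a) \<longlonglongrightarrow> 0"
      by (rule Lim_null_comparison[rotated]) (simp add: le)
    then show ?thesis by (simp add: LIM_zero_iff)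
  qed
  define E where "E = {a \<in> ?B. f a = g a}"
  have "closed E"
  proof (unfold closed_sequential_limits, intro allI impI, elim conjE)
    fix X a assume XE: "\<forall>n. X n \<in> E" and lim: "X \<longlonglongrightarrow> a"
    have XB: "X n \<in> ?B" and fg: "f (X n) = g (X n)" for n using XE by (auto simp: E_def)
    have aB: "a \<in> ?B" by (rule closed_sequentially[OF clB XB lim])
    have "f a = g a"
      using cont[OF homs(1) XB lim aB] cont[OF homs(2) XB lim aB] unfolding fg
      by (rule LIMSEQ_unique)
    with aB show "a \<in> E" by (simp add: E_def)
  qed
  moreover have "complex_vector.subspace E"
    using sub by (simp add: E_def complex_vector.subspace_def star_hom_on_zero[OF homs(1)]
        star_hom_on_zero[OF homs(2)] star_hom_on_add[OF homs(1)] star_hom_on_add[OF homs(2)]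
        star_hom_on_scaleC[OF homs(1)] star_hom_on_scaleC[OF homs(2)])
  moreover have "\<forall>a\<in>E. \<forall>b\<in>E. a * b \<in> E" "\<forall>a\<in>E. star a \<in> E"
    using mB sB by (simp_all add: E_def star_hom_on_mult[OF homs(1)] star_hom_on_mult[OF homs(2)]
        star_hom_on_star[OF homs(1)] star_hom_on_star[OF homs(2)])
  ultimately have "cstar_subalgebra E" by (simp add: cstar_subalgebra_def)
  moreover have "insert U (range \<pi>) \<subseteq> E"
    using hull_subset[of "insert U (range \<pi>)" cstar_subalgebra, folded cstar_generated_def] eq
    unfolding E_def by blast
  ultimately have "?B \<subseteq> E" unfolding cstar_generated_def by (intro hull_minimal)
  then show ?thesis using x by (auto simp: E_def)
qed

theorem theorem5p1:
  fixes \<delta> :: "'a :: unital_cstar_algebra \<Rightarrow> 'a"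
    and J :: "'a set"
    and \<pi>\<^sub>1 :: "'a \<Rightarrow> 'h\<^sub>1 :: chilbert_space bop" and U\<^sub>1 :: "'h\<^sub>1 bop"
    and \<pi>\<^sub>2 :: "'a \<Rightarrow> 'h\<^sub>2 :: chilbert_space bop" and U\<^sub>2 :: "'h\<^sub>2 bop"
  assumes "star_hom_on UNIV \<delta>"
    and "cstar_ideal J"
    and "J \<inter> {a. \<delta> a = 0} = {0}"
    and "covariant_representation \<delta> \<pi>\<^sub>1 U\<^sub>1"
    and "covariant_representation \<delta> \<pi>\<^sub>2 U\<^sub>2"
    and "associated_with_ideal \<pi>\<^sub>1 U\<^sub>1 J"
    and "associated_with_ideal \<pi>\<^sub>2 U\<^sub>2 J"
    and "property_star \<delta> \<pi>\<^sub>1 U\<^sub>1"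
    and "property_star \<delta> \<pi>\<^sub>2 U\<^sub>2"
  shows "\<exists>!\<Phi>. \<Phi> \<in> extensional (cstar_generated \<pi>\<^sub>1 U\<^sub>1)
      \<and> star_isomorphism (cstar_generated \<pi>\<^sub>1 U\<^sub>1) (cstar_generated \<pi>\<^sub>2 U\<^sub>2) \<Phi>
      \<and> (\<forall>a. \<Phi> (\<pi>\<^sub>1 a) = \<pi>\<^sub>2 a) \<and> \<Phi> U\<^sub>1 = U\<^sub>2"
proof -
  have 1: "covariant \<delta> \<pi>\<^sub>1 U\<^sub>1" and 2: "covariant \<delta> \<pi>\<^sub>2 U\<^sub>2"
    using assms by (simp_all add: covariant_def)
  have "norm (covariant.val \<pi>\<^sub>1 U\<^sub>1 w) = norm (covariant.val \<pi>\<^sub>2 U\<^sub>2 w)" for w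
    using norm_val_le_other_representation[OF 1 2 assms(6,7,9), of w] norm_val_le_other_representation[OF 2 1 assms(7,6,8), of w] by simp
  from exists_star_isomorphism_of_val[OF 1 2 this] show ?thesis
  proof (rule ex_ex1I)
    fix f g
    let ?good = "\<lambda>\<Phi>. \<Phi> \<in> extensional (cstar_generated \<pi>\<^sub>1 U\<^sub>1)
      \<and> star_isomorphism (cstar_generated \<pi>\<^sub>1 U\<^sub>1) (cstar_generated \<pi>\<^sub>2 U\<^sub>2) \<Phi>
      \<and> (\<forall>a. \<Phi> (\<pi>\<^sub>1 a) = \<pi>\<^sub>2 a) \<and> \<Phi> U\<^sub>1 = U\<^sub>2"
    assume f: "?good f" and g: "?good g"
    show "f = g"
    proof (rule extensionalityI[of f "cstar_generated \<pi>\<^sub>1 U\<^sub>1"])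
      fix x assume "x \<in> cstar_generated \<pi>\<^sub>1 U\<^sub>1"
      then show "f x = g x"
        by (rule star_hom_on_cstar_generated_eqI[OF 1, rotated 4])
          (use f g in \<open>auto simp: star_isomorphism_def\<close>)
    qed (use f g in auto)
  qed
qed

end
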